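(* Let $\xi,\xi_1,\xi_2,\ldots$ be i.i.d. real random variables with distribution function $F$, tail $\overline F(x)=1-F(x)$, and $\xi^-=\max\{-\xi,0\}$. Let $S_0=0$, $S_n=\xi_1+\cdots+\xi_n$, $\tau=\inf\{n\ge 1: S_n<0\}$ and $M_\tau=\max_{0\le i\le\tau}S_i$. Let $m(x)=\mathbf E\min\{\xi^-,x\}$ for $x\ge 0$. Suppose that $\mathbf E\xi^-=\infty$ and that $$K:=\int_0^\infty \frac{x}{m(x)}\,F(dx)<\infty .$$ Let $G_1$ be the distribution function on $[0,\infty)$ with tail $$\overline G_1(x)=\frac1K\int_x^\infty \frac{t-x}{m(t-x)}\,F(dt),\qquad x\ge 0.$$ If $G_1\in\mathcal S_F$, then $$\mathbf P(M_\tau>x)\sim \mathbf E[\tau]\,\overline F(x),\qquad x\to\infty.$$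
   Context: Notation: $f(x)\sim g(x)$ means $f(x)/g(x)\to 1$ as $x\to\infty$. Class $\mathcal S_F$: for a distribution function $F$ on $\mathbb R$ with tail $\overline F=1-F$, a distribution function $G$ on $[0,\infty)$ belongs to $\mathcal S_F$ if $\int_0^x G(du)\,\overline F(x-u)\sim\overline F(x)$ as $x\to\infty$, where the integral is over $[0,x]$ (so a mass of $G$ at $0$ is included). In particular $G\in\mathcal S_F$ presupposes $\overline F(x)>0$ for all $x$. The integrals defining $K$ and $\overline G_1(x)$ are over $(0,\infty)$ and $(x,\infty)$ respectively. Note $m(x)>0$ for every $x>0$ since $\mathbf E\xi^-=\infty$. It is known that, when $\mathbf E\xi^-=\infty$, the condition $K<\infty$ is equivalent to $S_n\to-\infty$ a.s., and that the latter is equivalent to $\mathbf E\tau<\infty$. *)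

theory Defs
  imports "HOL-Probability.Probability" "HOL-Library.Landau_Symbols"
begin

unbundle asymp_equiv_syntax

text \<open>
  Distribution functions are functions \<^typ>\<open>real \<Rightarrow> real\<close>; an integral against \<open>F(dx)\<close> is an
  integral with respect to \<^term>\<open>interval_measure F\<close>.
\<close>

definition distribution_function :: "(real \<Rightarrow> real) \<Rightarrow> bool" where
  "distribution_function F \<longleftrightarrow>
     mono F \<and> (\<forall>a. continuous (at_right a) F) \<and>
     (F \<longlongrightarrow> 0) at_bot \<and> (F \<longlongrightarrow> 1) at_top"

definition tail :: "(real \<Rightarrow> real) \<Rightarrow> real \<Rightarrow> real" where
  "tail F x = 1 - F x"

text \<open>
  The relation \<open>\<sim>[at_top]\<close> of the library regards \<open>0 / 0\<close> as \<open>1\<close>. This has no effect here, because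
  positivity of the tail is part of the definition.
\<close>

definition class_S :: "(real \<Rightarrow> real) \<Rightarrow> (real \<Rightarrow> real) set" where
  "class_S F = {G. distribution_function G \<and> (\<forall>x<0. G x = 0) \<and>
     (\<forall>x. tail F x > 0) \<and>
     (\<lambda>x. LINT u:{0..x}|interval_measure G. tail F (x - u)) \<sim>[at_top] tail F}"

definition neg_part :: "real \<Rightarrow> real" where
  "neg_part y = max (- y) 0"

text \<open>In the theorem \<open>X\<close> is the generic copy \<open>\<xi> 0\<close> of the increments \<open>\<xi> 1, \<xi> 2, \<dots>\<close> of the walk.\<close>

definition trunc_mean :: "'a measure \<Rightarrow> ('a \<Rightarrow> real) \<Rightarrow> real \<Rightarrow> real" where
  "trunc_mean M X x = (LINT \<omega>|M. min (neg_part (X \<omega>)) x)"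

definition K_const :: "(real \<Rightarrow> real) \<Rightarrow> (real \<Rightarrow> real) \<Rightarrow> ennreal" where
  "K_const F m = (\<integral>\<^sup>+x\<in>{0<..}. ennreal (x / m x) \<partial>interval_measure F)"

definition G1 :: "(real \<Rightarrow> real) \<Rightarrow> (real \<Rightarrow> real) \<Rightarrow> real \<Rightarrow> real" where
  "G1 F m x = (if x < 0 then 0 else
     1 - 1 / enn2real (K_const F m) *
       (LINT t:{x<..}|interval_measure F. (t - x) / m (t - x)))"

definition walk :: "(nat \<Rightarrow> 'a \<Rightarrow> real) \<Rightarrow> nat \<Rightarrow> 'a \<Rightarrow> real" where
  "walk \<xi> n \<omega> = (\<Sum>i=1..n. \<xi> i \<omega>)"

text \<open>The infimum of the empty set is \<open>\<infinity>\<close> in \<^typ>\<open>enat\<close>.\<close>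

definition tau :: "(nat \<Rightarrow> 'a \<Rightarrow> real) \<Rightarrow> 'a \<Rightarrow> enat" where
  "tau \<xi> \<omega> = Inf (enat ` {n. n \<ge> 1 \<and> walk \<xi> n \<omega> < 0})"

text \<open>
  The supremum is a maximum of finitely many reals when \<open>tau \<xi> \<omega>\<close> is finite; otherwise it ranges
  over all indices and may be \<open>\<infinity>\<close>.
\<close>

definition M_tau :: "(nat \<Rightarrow> 'a \<Rightarrow> real) \<Rightarrow> 'a \<Rightarrow> ereal" where
  "M_tau \<xi> \<omega> = (SUP i\<in>{i. enat i \<le> tau \<xi> \<omega>}. ereal (walk \<xi> i \<omega>))"

text \<open>
  The theorem states \<open>P(M_tau > x) \<sim> enn2real mean_tau * tail F x\<close> without assuming \<open>mean_tau\<close> to be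
  finite. An infinite mean would make the right-hand side \<open>0\<close>, whereas the left-hand side is at
  least the positive tail of \<open>F\<close>; so the conversion does not weaken the conclusion.
\<close>

definition mean_tau :: "'a measure \<Rightarrow> (nat \<Rightarrow> 'a \<Rightarrow> real) \<Rightarrow> ennreal" where
  "mean_tau M \<xi> = (\<integral>\<^sup>+\<omega>. ennreal_of_enat (tau \<xi> \<omega>) \<partial>M)"

end

theory Submission
  imports Defs
begin

text \<open>
  Let \<open>T\<close> be the tail of \<open>F\<close>. Splitting \<open>{M_\<tau> > x}\<close> at the step that first crosses \<open>x\<close> gives
  \<open>P(M_\<tau> > x) = \<Sum>n. E[T(x - S\<^sub>n); S\<^sub>0, \<dots>, S\<^sub>n \<in> [0,x]]\<close>, while
  \<open>E \<tau> = \<Sum>n. P(S\<^sub>0, \<dots>, S\<^sub>n \<ge> 0)\<close>. Since \<open>T(x - S\<^sub>n) \<ge> T(x)\<close>, the lower bound is monotone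
  convergence. All the work is in the upper bound: crossings of \<open>x\<close> from a position far above \<open>0\<close>
  must be negligible compared with \<open>T(x)\<close>, and \<open>E \<tau>\<close> must be finite.

  Both facts come from supersolutions, that is, from functions \<open>W\<close> whose expected decrease in one
  step dominates the quantity to be summed along the killed walk; the one-step Markov property turns
  such an inequality into a bound of the whole sum (\<open>occupation_le\<close>). The building block is a
  concave function \<open>V\<close> on \<open>(0,\<infinity>)\<close>, comparable to \<open>x / m(x)\<close>, that decreases by at least \<open>1\<close> in
  expectation when its argument is lowered by \<open>\<xi>\<^sup>-\<close> (\<open>V_drift\<close>). It is integrable because \<open>K\<close> is
  finite, and its increments vanish at infinity because \<open>m\<close> is unbounded, so upward steps cannot
  compensate that decrease far out. Hence \<open>2 V + const\<close> is a supersolution that proves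
  \<open>E \<tau> < \<infinity>\<close> (\<open>supersolution_half_line\<close>).

  For the upper bound put \<open>Q(z) = E V(\<xi> - z)\<close>, which is comparable to the tail of \<open>G\<^sub>1\<close>. Lowering
  \<open>\<xi> - z\<close> by \<open>\<xi>\<^sup>-\<close> shows that \<open>y \<mapsto> Q(x - y)\<close> loses at least \<open>T(x - y) - T(x)\<close> on average through the
  downward steps of the walk, and the gain through upward steps is a quantity \<open>e(x - y)\<close>. The
  hypothesis \<open>G\<^sub>1 \<in> S_F\<close> says exactly that the analogous gain \<open>\<psi>\<close> for the tail of \<open>G\<^sub>1\<close> is
  \<open>o(T)\<close>; it also forces \<open>F\<close> to be long-tailed, and together these make \<open>e = o(T)\<close>
  (\<open>e_negligible\<close>). Therefore \<open>W(y) = \<kappa> (Q(x - y) - Q(x))\<close>, up to a bounded shift of \<open>x\<close>, absorbs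
  the cost \<open>T(x - y)\<close> at every \<open>y > A\<close> up to an error \<open>\<kappa> T(x)\<close>, and at every \<open>y \<le> A\<close> up to
  \<open>(1 + \<epsilon>) T(x)\<close> (\<open>supersolution_interval\<close>). Because \<open>W(0) = 0\<close>, this yields
  \<open>P(M_\<tau> > x) \<le> T(x) ((1 + \<epsilon>) E \<tau> + \<kappa> \<Sum>n. P(\<tau> > n, S\<^sub>n > A))\<close>, and the last sum tends to \<open>0\<close> as
  \<open>A\<close> grows because \<open>E \<tau>\<close> is finite.
\<close>

section \<open>The truncated mean of the negative part\<close>

text \<open>
  The analytic part concerns the law \<open>\<mu>\<close> of a single increment; applied to the identity,
  \<^const>\<open>trunc_mean\<close> is the function \<open>m\<close> of this law.
\<close>

locale heavy_left_law = real_distribution \<mu> for \<mu> :: "real measure" +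
  assumes infinite_neg_mean: "(\<integral>\<^sup>+t. ennreal (neg_part t) \<partial>\<mu>) = \<infinity>"
    and finite_K: "(\<integral>\<^sup>+t\<in>{0<..}. ennreal (t / trunc_mean \<mu> (\<lambda>t. t) t) \<partial>\<mu>) < \<infinity>"
begin

abbreviation m :: "real \<Rightarrow> real" where
  "m \<equiv> trunc_mean \<mu> (\<lambda>t. t)"

lemma prob_UNIV [simp]: "measure \<mu> UNIV = 1"
  using prob_space by simp

lemma neg_part_nonneg [simp]: "neg_part t \<ge> 0"
  by (simp add: neg_part_def)

lemma neg_part_measurable [measurable]: "neg_part \<in> borel_measurable borel"
  unfolding neg_part_def by measurable

lemma integrable_bounded_borel:
  assumes "f \<in> borel_measurable borel" "\<And>t. \<bar>f t :: real\<bar> \<le> B"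
  shows "integrable \<mu> f"
  by (rule integrable_const_bound[where B=B]) (use assms in auto)

lemma integrable_min_neg_part:
  assumes "x \<ge> 0"
  shows "integrable \<mu> (\<lambda>t. min (neg_part t) x)"
  by (rule integrable_bounded_borel[where B=x]) (use assms in auto)

lemma m_mono:
  assumes "0 \<le> x" "x \<le> y"
  shows "m x \<le> m y"
  unfolding trunc_mean_def
  by (intro integral_mono integrable_min_neg_part) (use assms in auto)

lemma m_pos:
  assumes "x > 0"
  shows "m x > 0"
proof (rule ccontr)
  assume "\<not> m x > 0"
  moreover have "m x \<ge> 0"
    unfolding trunc_mean_def by (rule Bochner_Integration.integral_nonneg) (use assms in auto)
  ultimately have "m x = 0" by simp
  then have "AE t in \<mu>. min (neg_part t) x = 0"
    unfolding trunc_mean_def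
    by (subst (asm) integral_nonneg_eq_0_iff_AE[OF integrable_min_neg_part]) (use assms in auto)
  then have "AE t in \<mu>. ennreal (neg_part t) = 0"
    by eventually_elim (use assms in \<open>auto simp: min_def split: if_splits\<close>)
  then have "(\<integral>\<^sup>+t. ennreal (neg_part t) \<partial>\<mu>) = 0"
    by (simp add: nn_integral_0_iff_AE)
  then show False using infinite_neg_mean by simp
qed

text \<open>
  As a mean of functions that are concave in \<open>x\<close> and vanish at \<open>0\<close>, \<open>m\<close> has a decreasing ratio
  \<open>m(x) / x\<close>.
\<close>

lemma m_concave_ratio:
  assumes "0 < x" "x \<le> y"
  shows "x * m y \<le> y * m x"
proof -
  have "x * min (neg_part t) y \<le> y * min (neg_part t) x" for t
  proof (cases "neg_part t \<le> x")
    case True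
    then have "x * neg_part t \<le> y * neg_part t" using assms by (intro mult_right_mono) auto
    then show ?thesis using True assms by (simp add: min_absorb1)
  next
    case False
    then have "x * min (neg_part t) y \<le> x * y" using assms by (intro mult_left_mono) auto
    then show ?thesis using False by (simp add: min_def mult.commute)
  qed
  then have "(\<integral>t. x * min (neg_part t) y \<partial>\<mu>) \<le> (\<integral>t. y * min (neg_part t) x \<partial>\<mu>)"
    by (intro integral_mono integrable_mult_right integrable_min_neg_part) (use assms in auto)
  then show ?thesis by (simp add: trunc_mean_def)
qed

text \<open>
  The slope of \<open>m\<close> beyond \<open>x\<close> is at most the probability that the truncation at \<open>x\<close> is active.
\<close>

lemma m_growth:
  assumes "0 < x" "x \<le> y"
  shows "m y \<le> m x + (y - x) * measure \<mu> {t. neg_part t \<ge> x}"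
proof -
  have I: "integrable \<mu> (\<lambda>t. (y - x) * indicator {t. neg_part t \<ge> x} t)"
    by (intro integrable_mult_right integrable_bounded_borel[where B=1]) (auto simp: indicator_def)
  have J: "integrable \<mu> (\<lambda>t. min (neg_part t) x)" "integrable \<mu> (\<lambda>t. min (neg_part t) y)"
    using assms by (auto intro!: integrable_min_neg_part)
  have "m y \<le> (\<integral>t. min (neg_part t) x + (y - x) * indicator {t. neg_part t \<ge> x} t \<partial>\<mu>)"
    unfolding trunc_mean_def
    by (intro integral_mono Bochner_Integration.integrable_add I J)
       (use assms in \<open>auto simp: indicator_def\<close>)
  also have "\<dots> = m x + (y - x) * measure \<mu> {t. neg_part t \<ge> x}"
    unfolding trunc_mean_def by (subst Bochner_Integration.integral_add[OF J(1) I]) simp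
  finally show ?thesis .
qed

lemma m_at_top: "filterlim m at_top at_top"
proof -
  have sup: "(\<Squnion>n. \<integral>\<^sup>+t. ennreal (min (neg_part t) (real n)) \<partial>\<mu>) = \<infinity>"
  proof -
    have "(\<Squnion>n. \<integral>\<^sup>+t. ennreal (min (neg_part t) (real n)) \<partial>\<mu>) =
          (\<integral>\<^sup>+t. (\<Squnion>n. ennreal (min (neg_part t) (real n))) \<partial>\<mu>)"
      by (intro nn_integral_monotone_convergence_SUP[symmetric])
         (auto simp: incseq_def le_fun_def intro!: ennreal_leI)
    also have "\<dots> = (\<integral>\<^sup>+t. ennreal (neg_part t) \<partial>\<mu>)"
    proof (intro nn_integral_cong antisym SUP_least)
      fix t
      obtain n where "neg_part t \<le> real n" using real_arch_simple by blast
      then have "ennreal (neg_part t) = ennreal (min (neg_part t) (real n))" by simp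
      then show "ennreal (neg_part t) \<le> (\<Squnion>n. ennreal (min (neg_part t) (real n)))"
        by (metis SUP_upper UNIV_I)
    qed (auto intro!: ennreal_leI)
    finally show ?thesis using infinite_neg_mean by simp
  qed
  show ?thesis unfolding filterlim_at_top
  proof
    fix B :: real
    have "ennreal B < (\<Squnion>n. \<integral>\<^sup>+t. ennreal (min (neg_part t) (real n)) \<partial>\<mu>)"
      unfolding sup by simp
    then obtain n where "ennreal B < (\<integral>\<^sup>+t. ennreal (min (neg_part t) (real n)) \<partial>\<mu>)"
      by (auto simp: less_SUP_iff)
    also have "\<dots> = ennreal (m (real n))"
      unfolding trunc_mean_def by (rule nn_integral_eq_integral[OF integrable_min_neg_part]) auto
    finally have B: "B \<le> m (real n)"
      by (metis ennreal_leI leD linear)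
    have "B \<le> m x" if "x \<ge> real n" for x
      using B m_mono[of "real n" x] that by simp
    then show "eventually (\<lambda>x. B \<le> m x) at_top"
      by (auto simp: eventually_at_top_linorder)
  qed
qed

section \<open>A concave function with unit drift\<close>

definition g :: "real \<Rightarrow> real" where
  "g s = (if s > 0 then s / m s else 0)"

lemma g_nonneg [simp]: "g s \<ge> 0"
  using m_pos[of s] by (auto simp: g_def)

lemma g_mono: "s \<le> s' \<Longrightarrow> g s \<le> g s'"
proof -
  assume le: "s \<le> s'"
  show ?thesis
  proof (cases "s > 0")
    case True
    then show ?thesis
      using le m_concave_ratio[OF True le] m_pos[of s] m_pos[of s']
      by (simp add: g_def field_simps)
  next
    case False
    then show ?thesis by (metis g_def g_nonneg)
  qed
qed

lemma g_measurable [measurable]: "g \<in> borel_measurable borel"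
  by (rule borel_measurable_mono) (auto simp: mono_def g_mono)

lemma g_integrable: "integrable \<mu> g"
proof (rule integrableI_nonneg)
  have "(\<integral>\<^sup>+t. ennreal (g t) \<partial>\<mu>) = (\<integral>\<^sup>+t\<in>{0<..}. ennreal (t / m t) \<partial>\<mu>)"
    by (intro nn_integral_cong) (auto simp: g_def indicator_def)
  then show "(\<integral>\<^sup>+t. ennreal (g t) \<partial>\<mu>) < \<infinity>" using finite_K by simp
qed auto

text \<open>
  The function \<open>g\<close> is increasing and \<open>g(x) / x\<close> is decreasing, so \<open>g\<close> is within a factor \<open>2\<close> of a
  concave function. The infimum of the affine functions \<open>x \<mapsto> (s + x) / m(s)\<close> is such a function, in
  closed form: it lies above \<open>g\<close>, and \<open>s = x\<close> gives the upper bound \<open>2 g(x)\<close>. The factor \<open>7\<close>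
  normalizes the drift to \<open>1\<close>. The value \<open>0\<close> on \<open>(-\<infinity>,0]\<close> builds in the killing of the walk; it
  leaves a positive jump of \<open>V\<close> at \<open>0\<close>.
\<close>

definition V :: "real \<Rightarrow> real" where
  "V x = (if x > 0 then 7 * (INF s\<in>{0<..}. (s + x) / m s) else 0)"

lemma V_nonpos [simp]: "x \<le> 0 \<Longrightarrow> V x = 0"
  by (simp add: V_def)

lemma V_le: "x > 0 \<Longrightarrow> s > 0 \<Longrightarrow> V x \<le> 7 * ((s + x) / m s)"
proof -
  assume "x > 0" and "s > 0"
  have "bdd_below ((\<lambda>s. (s + x) / m s) ` {0<..})"
  proof (rule bdd_belowI2)
    fix s :: real assume "s \<in> {0<..}"
    then show "0 \<le> (s + x) / m s" using \<open>x > 0\<close> m_pos[of s] by simp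
  qed
  moreover have "s \<in> {0<..}" using \<open>s > 0\<close> by simp
  ultimately have "(INF s\<in>{0<..}. (s + x) / m s) \<le> (s + x) / m s"
    by (rule cINF_lower)
  then have "7 * (INF s\<in>{0<..}. (s + x) / m s) \<le> 7 * ((s + x) / m s)"
    by (rule mult_left_mono) simp
  then show "V x \<le> 7 * ((s + x) / m s)"
    using \<open>x > 0\<close> by (simp only: V_def if_True)
qed

lemma V_ge:
  assumes "x > 0" "\<And>s. s > 0 \<Longrightarrow> c \<le> 7 * ((s + x) / m s)"
  shows "c \<le> V x"
proof -
  have scale: "c / 7 \<le> z" if "c \<le> 7 * z" for z :: real
    using that by simp
  have "c / 7 \<le> (INF s\<in>{0<..}. (s + x) / m s)"
  proof (rule cINF_greatest)
    show "{0::real<..} \<noteq> {}" by (auto intro: gt_ex)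
    fix s :: real assume "s \<in> {0<..}"
    then show "c / 7 \<le> (s + x) / m s" using assms(2) by (intro scale) simp
  qed
  then show ?thesis using assms(1) by (simp add: V_def)
qed

lemma V_ge_g: "7 * g x \<le> V x"
proof (cases "x > 0")
  case True
  show ?thesis
  proof (rule V_ge[OF True])
    fix s :: real assume s: "s > 0"
    have "g x \<le> (s + x) / m s"
    proof (cases "s \<le> x")
      case le: True
      have "g x = x / m x" using True by (simp add: g_def)
      also have "\<dots> \<le> (s + x) / m s"
        using m_mono[of s x] m_pos[OF s] True le s by (intro frac_le) auto
      finally show ?thesis .
    next
      case False
      then have "g x \<le> g s" by (intro g_mono) simp
      also have "\<dots> = s / m s" using s by (simp add: g_def)
      also have "\<dots> \<le> (s + x) / m s"
        using True m_pos[OF s] by (intro divide_right_mono) auto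
      finally show ?thesis .
    qed
    then show "7 * g x \<le> 7 * ((s + x) / m s)" by (rule mult_left_mono) simp
  qed
qed (simp add: g_def)

lemma V_le_g: "V x \<le> 14 * g x"
proof (cases "x > 0")
  case True
  then show ?thesis using V_le[OF True True] by (simp add: g_def)
qed (simp add: g_def)

lemma V_nonneg [simp]: "V x \<ge> 0"
  using V_ge_g[of x] g_nonneg[of x] by linarith

lemma V_mono: "x \<le> y \<Longrightarrow> V x \<le> V y"
proof -
  assume le: "x \<le> y"
  show ?thesis
  proof (cases "x > 0")
    case True
    then have "y > 0" using le by simp
    then show ?thesis
    proof (rule V_ge)
      fix s :: real assume s: "s > 0"
      have "V x \<le> 7 * ((s + x) / m s)" by (rule V_le[OF True s])
      also have "\<dots> \<le> 7 * ((s + y) / m s)"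
        using le m_pos[OF s] by (intro mult_left_mono divide_right_mono) auto
      finally show "V x \<le> 7 * ((s + y) / m s)" .
    qed
  qed simp
qed

lemma V_measurable [measurable]: "V \<in> borel_measurable borel"
  by (rule borel_measurable_mono) (auto simp: mono_def V_mono)

lemma V_integrable: "integrable \<mu> V"
  by (rule Bochner_Integration.integrable_bound[of _ "\<lambda>t. 14 * g t"])
     (auto intro: g_integrable V_le_g)

text \<open>
  Concavity and a nonnegative limit at \<open>0+\<close> make \<open>V(x) / x\<close> decreasing.
\<close>

lemma V_ratio:
  assumes "0 < x" "x \<le> y"
  shows "x * V y \<le> y * V x"
proof -
  have "x * V y / y \<le> V x"
  proof (rule V_ge[OF assms(1)])
    fix s :: real assume s: "s > 0"
    have "x * V y / y \<le> x * (7 * ((s + y) / m s)) / y"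
      using assms V_le[of y s] s by (intro divide_right_mono mult_left_mono) auto
    also have "\<dots> = 7 * ((x * s / y + x) / m s)"
      using assms m_pos[OF s] by (simp add: field_simps)
    also have "\<dots> \<le> 7 * ((s + x) / m s)"
    proof -
      have "x * s / y \<le> s" using assms s by (simp add: field_simps)
      then show ?thesis using m_pos[OF s] by (intro mult_left_mono divide_right_mono) auto
    qed
    finally show "x * V y / y \<le> 7 * ((s + x) / m s)" .
  qed
  then show ?thesis using assms by (simp add: field_simps)
qed

lemma V_subadditive:
  assumes "v \<ge> 0"
  shows "V (s + v) \<le> V s + V v"
proof (cases "s > 0 \<and> v > 0")
  case True
  then have "s * V (s + v) \<le> (s + v) * V s" "v * V (s + v) \<le> (s + v) * V v"
    by (auto intro!: V_ratio)
  then have "(s + v) * V (s + v) \<le> (s + v) * (V s + V v)" by (simp add: algebra_simps)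
  then show ?thesis using True by simp
next
  case False
  then consider "s \<le> 0" | "v = 0" using assms by linarith
  then show ?thesis
  proof cases
    case 1
    then have "V (s + v) \<le> V v" by (intro V_mono) simp
    then show ?thesis by (simp add: add_increasing)
  qed simp
qed

text \<open>
  A chord of \<open>V\<close> to the right of \<open>s\<close> is at most as steep as the chord from the origin to \<open>s\<close>, whose
  slope is at most \<open>14 / m(s)\<close>.
\<close>

lemma V_increment_le:
  assumes "0 < R" "R \<le> s" "v \<ge> 0"
  shows "V (s + v) - V s \<le> 14 * v / m R"
proof -
  have "s > 0" using assms by simp
  have "s * V (s + v) \<le> (s + v) * V s" using assms by (intro V_ratio) auto
  then have "s * (V (s + v) - V s) \<le> v * V s" by (simp add: algebra_simps)
  also have "\<dots> \<le> v * (14 * g s)" using assms V_le_g by (intro mult_left_mono) auto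
  also have "\<dots> = s * (14 * v / m s)" using \<open>s > 0\<close> by (simp add: g_def)
  finally have "V (s + v) - V s \<le> 14 * v / m s"
    using \<open>s > 0\<close> by (rule mult_left_le_imp_le)
  also have "\<dots> \<le> 14 * v / m R"
    using assms m_mono[of R s] m_pos[of R] by (intro divide_left_mono) auto
  finally show ?thesis .
qed

text \<open>
  Concavity at the point \<open>x\<close> between \<open>x - u\<close> and \<open>8 x\<close>.
\<close>

lemma V_concave:
  assumes "0 < u" "u < x"
  shows "7 * x * V (x - u) + u * V (8 * x) \<le> (7 * x + u) * V x"
proof -
  have pos: "7 * x + u > 0" "x > 0" using assms by auto
  have "(7 * x * V (x - u) + u * V (8 * x)) / (7 * x + u) \<le> V x"
  proof (rule V_ge[OF pos(2)])
    fix s :: real assume s: "s > 0"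
    have "7 * x * V (x - u) + u * V (8 * x) \<le>
          7 * x * (7 * ((s + (x - u)) / m s)) + u * (7 * ((s + 8 * x) / m s))"
      using assms s by (intro add_mono mult_left_mono V_le) auto
    also have "\<dots> = (7 * x + u) * (7 * ((s + x) / m s))"
      using m_pos[OF s] by (simp add: field_simps)
    finally show "(7 * x * V (x - u) + u * V (8 * x)) / (7 * x + u) \<le> 7 * ((s + x) / m s)"
      using pos by (simp add: pos_divide_le_eq mult.commute)
  qed
  then show ?thesis using pos by (simp add: pos_divide_le_eq mult.commute)
qed

lemma integrable_V_shift:
  assumes [measurable]: "f \<in> borel_measurable borel" and le: "\<And>t. f t \<le> c + max t 0"
  shows "integrable \<mu> (\<lambda>t. V (f t))"
proof (rule Bochner_Integration.integrable_bound)
  show "integrable \<mu> (\<lambda>t. V c + V t)" using V_integrable by simp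
  show "AE t in \<mu>. norm (V (f t)) \<le> norm (V c + V t)"
  proof (rule AE_I2)
    fix t
    have "V (f t) \<le> V (c + max t 0)" by (rule V_mono[OF le])
    also have "\<dots> \<le> V c + V (max t 0)" by (rule V_subadditive) simp
    also have "V (max t 0) = V t" by (auto simp: max_def)
    finally show "norm (V (f t)) \<le> norm (V c + V t)" by simp
  qed
qed auto

text \<open>
  If \<open>\<xi>\<^sup>-\<close> exceeds \<open>x\<close> with probability at least of order \<open>m(x) / x\<close>, then the loss of the whole value
  \<open>V(x)\<close> on that event suffices, because \<open>V(x) \<ge> 7 x / m(x)\<close>. Otherwise \<open>m\<close> at most doubles between
  \<open>x\<close> and \<open>8 x\<close>, so \<open>V(8 x)\<close> exceeds \<open>V(x)\<close> substantially; by concavity \<open>V\<close> is then steep on all of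
  \<open>(0,x]\<close> and the loss is at least the slope times \<open>m(x)\<close>.
\<close>

lemma V_drift:
  assumes "x > 0"
  shows "(\<integral>t. V (x - neg_part t) \<partial>\<mu>) \<le> V x - 1"
proof -
  let ?p = "measure \<mu> {t. neg_part t \<ge> x}"
  \<comment> \<open>the slope of the chord from \<open>x\<close> to \<open>8 x\<close>, a lower bound for the slopes to the left of \<open>x\<close>\<close>
  define \<sigma> where "\<sigma> = (V (8 * x) - V x) / (7 * x)"
  have int: "integrable \<mu> (\<lambda>t. V (x - neg_part t))"
    by (rule integrable_V_shift[of _ x]) (auto simp: max_def neg_part_def)
  have "1 \<le> (\<integral>t. V x - V (x - neg_part t) \<partial>\<mu>)"
  proof (cases "7 * x * ?p \<ge> m x")
    case True
    have "1 \<le> 7 * g x * ?p"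
      using True assms m_pos[OF assms] by (simp add: g_def field_simps)
    also have "\<dots> \<le> V x * ?p" by (intro mult_right_mono V_ge_g) simp
    also have "\<dots> = (\<integral>t. V x * indicator {t. neg_part t \<ge> x} t \<partial>\<mu>)" by simp
    also have "\<dots> \<le> (\<integral>t. V x - V (x - neg_part t) \<partial>\<mu>)"
      by (intro integral_mono integrable_mult_right Bochner_Integration.integrable_diff int
            integrable_bounded_borel[where B=1 and f="indicator {t. neg_part t \<ge> x}"])
         (auto simp: indicator_def intro!: V_mono)
    finally show ?thesis .
  next
    case False
    have "m (8 * x) \<le> m x + 7 * x * ?p" using m_growth[of x "8 * x"] assms by simp
    also have "\<dots> \<le> 2 * m x" using False by simp
    finally have m8: "m (8 * x) \<le> 2 * m x" .
    have "28 * x / m x = 7 * (8 * x / (2 * m x))" by simp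
    also have "\<dots> \<le> 7 * (8 * x / m (8 * x))"
      using m8 assms m_pos[of x] m_pos[of "8 * x"] by (intro mult_left_mono divide_left_mono) auto
    also have "\<dots> \<le> V (8 * x)" using V_ge_g[of "8 * x"] assms by (simp add: g_def)
    finally have "28 * x / m x \<le> V (8 * x)" .
    moreover have "V x \<le> 14 * x / m x" using V_le_g[of x] assms by (simp add: g_def)
    ultimately have "14 * x / m x \<le> V (8 * x) - V x" by simp
    then have "14 * x / m x / (7 * x) \<le> \<sigma>"
      unfolding \<sigma>_def using assms by (intro divide_right_mono) auto
    then have "2 \<le> \<sigma> * m x" using assms m_pos[OF assms] by (simp add: field_simps)
    then have "1 \<le> \<sigma> * m x" by simp
    also have "\<dots> = (\<integral>t. \<sigma> * min (neg_part t) x \<partial>\<mu>)" by (simp add: trunc_mean_def)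
    also have "\<dots> \<le> (\<integral>t. V x - V (x - neg_part t) \<partial>\<mu>)"
    proof (intro integral_mono integrable_mult_right integrable_min_neg_part
        Bochner_Integration.integrable_diff int)
      fix t
      consider "neg_part t = 0" | "0 < neg_part t" "neg_part t < x" | "neg_part t \<ge> x"
        using neg_part_nonneg[of t] by linarith
      then show "\<sigma> * min (neg_part t) x \<le> V x - V (x - neg_part t)"
      proof cases
        case 1
        then show ?thesis using assms by simp
      next
        case 2
        from V_concave[OF this]
        have "neg_part t * (V (8 * x) - V x) \<le> 7 * x * (V x - V (x - neg_part t))"
          by (simp add: algebra_simps)
        then show ?thesis using 2 assms by (simp add: \<sigma>_def field_simps)
      next
        case 3
        have "x * V (8 * x) \<le> 8 * x * V x" using assms by (intro V_ratio) auto
        then have "V (8 * x) \<le> 8 * V x" using assms by simp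
        then show ?thesis using 3 assms by (simp add: \<sigma>_def field_simps)
      qed
    qed (use assms in auto)
    finally show ?thesis .
  qed
  also have "\<dots> = V x - (\<integral>t. V (x - neg_part t) \<partial>\<mu>)"
    using int by simp
  finally show ?thesis by simp
qed

text \<open>
  A walk confined to \<open>[0,\<infinity>)\<close> cannot use more than \<open>y\<close> of a downward step from \<open>y\<close>. The truncation
  does not change \<open>V(s - \<xi>\<^sup>-)\<close> for \<open>s \<le> y\<close>, since both arguments are then nonpositive whenever they
  differ.
\<close>

lemma V_drift_truncated:
  assumes "y \<ge> 0"
  shows "(\<integral>t. V (s - min (neg_part t) y) \<partial>\<mu>) \<le> V s - indicator {0<..y} s"
proof -
  have int: "integrable \<mu> (\<lambda>t. V (s - min (neg_part t) y))"
    by (rule integrable_V_shift[of _ s])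
       (use assms in \<open>auto simp: max_def min_def neg_part_def\<close>)
  show ?thesis
  proof (cases "s \<in> {0<..y}")
    case True
    then have "V (s - min (neg_part t) y) = V (s - neg_part t)" for t
      by (auto simp: min_def)
    then show ?thesis using V_drift[of s] True by simp
  next
    case False
    have "(\<integral>t. V (s - min (neg_part t) y) \<partial>\<mu>) \<le> (\<integral>t. V s \<partial>\<mu>)"
      using assms by (intro integral_mono int) (auto intro!: V_mono)
    then show ?thesis using False by simp
  qed
qed

text \<open>
  A uniform bound for the mean gain of \<open>V\<close> through an upward step from a point beyond \<open>R\<close>. It
  combines subadditivity, which gives the integrable bound \<open>V\<close>, with the slope bound, which tends to
  \<open>0\<close>.
\<close>

definition \<Phi> :: "real \<Rightarrow> real" where
  "\<Phi> R = (\<integral>t. min (V t) (14 * max t 0 / m R) \<partial>\<mu>)"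

lemma V_increment_le_min:
  assumes "0 < R" "R \<le> s"
  shows "V (s + max t 0) - V s \<le> min (V t) (14 * max t 0 / m R)"
proof -
  have "V (max t 0) = V t" by (auto simp: max_def)
  then show ?thesis
    using V_increment_le[OF assms, of "max t 0"] V_subadditive[of "max t 0" s] by simp
qed

lemma min_V_bounds:
  assumes "R > 0"
  shows "0 \<le> min (V t) (14 * max t 0 / m R)" "\<bar>min (V t) (14 * max t 0 / m R)\<bar> \<le> V t"
proof -
  show "0 \<le> min (V t) (14 * max t 0 / m R)"
    using m_pos[OF assms] by (simp add: divide_nonneg_pos)
  then show "\<bar>min (V t) (14 * max t 0 / m R)\<bar> \<le> V t" by linarith
qed

lemma integrable_\<Phi>:
  assumes "R > 0"
  shows "integrable \<mu> (\<lambda>t. min (V t) (14 * max t 0 / m R))"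
  by (rule Bochner_Integration.integrable_bound[OF V_integrable])
     (use min_V_bounds[OF assms] in \<open>auto simp del: abs_le_iff\<close>)

lemma \<Phi>_tendsto_0: "(\<Phi> \<longlongrightarrow> 0) at_top"
proof -
  have "((\<lambda>R. \<integral>t. min (V t) (14 * max t 0 / m R) \<partial>\<mu>) \<longlongrightarrow> (\<integral>t. 0 \<partial>\<mu>)) at_top"
  proof (rule integral_dominated_convergence_at_top[where w=V])
    show "AE t in \<mu>. ((\<lambda>R. min (V t) (14 * max t 0 / m R)) \<longlongrightarrow> 0) at_top"
    proof (rule AE_I2)
      fix t
      have "((\<lambda>R. min (V t) (14 * max t 0 / m R)) \<longlongrightarrow> min (V t) 0) at_top"
        by (intro tendsto_min tendsto_const
            real_tendsto_divide_at_top[OF tendsto_const] m_at_top)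
      moreover have "min (V t) 0 = 0" by (simp add: min_absorb2)
      ultimately show "((\<lambda>R. min (V t) (14 * max t 0 / m R)) \<longlongrightarrow> 0) at_top"
        by (simp only:)
    qed
    show "\<forall>\<^sub>F R in at_top. AE t in \<mu>. norm (min (V t) (14 * max t 0 / m R)) \<le> V t"
      using eventually_gt_at_top[of 0]
      by eventually_elim (use min_V_bounds(2) in \<open>simp add: real_norm_def\<close>)
  qed (auto intro: V_integrable)
  then show ?thesis by (simp add: \<Phi>_def[abs_def])
qed

lemma negative_jumps_unbounded: "measure \<mu> {..<-R} > 0"
proof (rule ccontr)
  assume "\<not> measure \<mu> {..<-R} > 0"
  then have "measure \<mu> {..<-R} = 0" by (simp add: zero_less_measure_iff)
  then have "AE t in \<mu>. t \<notin> {..<-R}"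
    by (intro AE_not_in) (auto simp: null_sets_def emeasure_eq_measure)
  then have "AE t in \<mu>. ennreal (neg_part t) \<le> ennreal (max R 0)"
    by eventually_elim (auto simp: neg_part_def intro!: ennreal_leI)
  then have "(\<integral>\<^sup>+t. ennreal (neg_part t) \<partial>\<mu>) \<le> (\<integral>\<^sup>+t. ennreal (max R 0) \<partial>\<mu>)"
    by (rule nn_integral_mono_AE)
  then show False using infinite_neg_mean emeasure_space_1 by (simp add: top_unique)
qed

text \<open>
  Beyond some \<open>R\<close> the drift of \<open>2 V\<close> is at most \<open>-1\<close>. Below \<open>R\<close> it is bounded, and there a large
  additive constant helps: it is lost whenever the walk is killed, which has probability at least
  \<open>P(\<xi> < -R) > 0\<close>.
\<close>

lemma supersolution_half_line:
  obtains Y where "Y \<in> borel_measurable borel" "\<And>y. Y y \<ge> 0"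
    "\<And>y. y \<ge> 0 \<Longrightarrow>
      1 + (\<integral>\<^sup>+t. ennreal (Y (y + t)) * indicator {0..} (y + t) \<partial>\<mu>) \<le> ennreal (Y y)"
proof -
  have "\<forall>\<^sub>F R in at_top. \<Phi> R < 1 / 2 \<and> R > 0"
    by (intro eventually_conj order_tendstoD(2)[OF \<Phi>_tendsto_0] eventually_gt_at_top) simp
  then obtain R where R: "\<Phi> R < 1 / 2" "R > 0" by (auto simp: eventually_at_top_linorder)
  define p where "p = measure \<mu> {..<-R}"
  have p: "p > 0" unfolding p_def by (rule negative_jumps_unbounded)
  define EV where "EV = (\<integral>t. V t \<partial>\<mu>)"
  have EV: "EV \<ge> 0" unfolding EV_def by (rule Bochner_Integration.integral_nonneg) simp
  define b where "b = (2 * EV + 1) / p"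
  have b: "b \<ge> 0" "b * p = 2 * EV + 1" using p EV by (auto simp: b_def)
  have intV: "integrable \<mu> (\<lambda>t. V (y + t))" for y
    by (rule integrable_V_shift[of _ y]) auto
  have intN: "integrable \<mu> (\<lambda>t. V (y - neg_part t))" for y
    by (rule integrable_V_shift[of _ y]) (auto simp: max_def neg_part_def)
  have split: "V (y + t) = V (y - neg_part t) + (V (y + max t 0) - V y)" for y t
    by (auto simp: neg_part_def max_def)
  have far: "(\<integral>t. V (y + t) \<partial>\<mu>) \<le> V y - 1 / 2" if "y \<ge> R" for y
  proof -
    have "(\<integral>t. V (y + t) \<partial>\<mu>) \<le>
          (\<integral>t. V (y - neg_part t) + min (V t) (14 * max t 0 / m R) \<partial>\<mu>)"
    proof (intro integral_mono Bochner_Integration.integrable_add intN intV integrable_\<Phi>[OF R(2)])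
      show "V (y + t) \<le> V (y - neg_part t) + min (V t) (14 * max t 0 / m R)" for t
        using V_increment_le_min[OF R(2) that, of t] split[of y t] by linarith
    qed
    also have "\<dots> = (\<integral>t. V (y - neg_part t) \<partial>\<mu>) + \<Phi> R"
      unfolding \<Phi>_def by (intro Bochner_Integration.integral_add intN integrable_\<Phi> R)
    also have "\<dots> \<le> V y - 1 / 2" using V_drift[of y] R that by simp
    finally show ?thesis .
  qed
  have near: "(\<integral>t. V (y + t) \<partial>\<mu>) \<le> V y + EV" for y
  proof -
    have "V (y + t) \<le> V y + V t" for t
      using V_subadditive[of t y] V_mono[of "y + t" y] by (cases "t \<ge> 0") (auto simp: add_increasing2)
    then have "(\<integral>t. V (y + t) \<partial>\<mu>) \<le> (\<integral>t. V y + V t \<partial>\<mu>)"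
      using V_integrable by (intro integral_mono intV) auto
    also have "\<dots> = V y + EV" using V_integrable by (simp add: EV_def prob_space)
    finally show ?thesis .
  qed
  show thesis
  proof (rule that[of "\<lambda>y. 2 * V y + b"])
    fix y :: real assume y: "y \<ge> 0"
    have int: "integrable \<mu> (\<lambda>t. 2 * V (y + t) + b * indicator {-y..} t)"
      using intV by (intro Bochner_Integration.integrable_add integrable_mult_right
          integrable_bounded_borel[where B=1 and f="indicator {-y..}"]) (auto simp: indicator_def)
    have "(\<integral>\<^sup>+t. ennreal (2 * V (y + t) + b) * indicator {0..} (y + t) \<partial>\<mu>) \<le>
          (\<integral>\<^sup>+t. ennreal (2 * V (y + t) + b * indicator {-y..} t) \<partial>\<mu>)"
      by (intro nn_integral_mono) (auto simp: indicator_def)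
    also have "\<dots> = ennreal (\<integral>t. 2 * V (y + t) + b * indicator {-y..} t \<partial>\<mu>)"
      by (rule nn_integral_eq_integral[OF int]) (use b in auto)
    also have "(\<integral>t. 2 * V (y + t) + b * indicator {-y..} t \<partial>\<mu>) =
               2 * (\<integral>t. V (y + t) \<partial>\<mu>) + b * measure \<mu> {-y..}"
    proof -
      have "integrable \<mu> (\<lambda>t. b * indicator {-y..} t)"
        by (intro integrable_mult_right integrable_bounded_borel[where B=1]) (auto simp: indicator_def)
      then show ?thesis using intV by (subst Bochner_Integration.integral_add) auto
    qed
    also have "measure \<mu> {-y..} = 1 - measure \<mu> {..<-y}"
    proof -
      have "{-y..} = UNIV - {..<-y}" by auto
      then show ?thesis using prob_compl[of "{..<-y}"] by simp
    qed
    finally have "(\<integral>\<^sup>+t. ennreal (2 * V (y + t) + b) * indicator {0..} (y + t) \<partial>\<mu>) \<le>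
        ennreal (2 * (\<integral>t. V (y + t) \<partial>\<mu>) + b * (1 - measure \<mu> {..<-y}))" .
    also have "\<dots> \<le> ennreal (2 * V y + b - 1)"
    proof (rule ennreal_leI, cases "y \<ge> R")
      case True
      have "b * (1 - measure \<mu> {..<-y}) \<le> b * 1" using b by (intro mult_left_mono) auto
      then show "2 * (\<integral>t. V (y + t) \<partial>\<mu>) + b * (1 - measure \<mu> {..<-y}) \<le> 2 * V y + b - 1"
        using far[OF True] by simp
    next
      case False
      have "p \<le> measure \<mu> {..<-y}" unfolding p_def using False by (intro finite_measure_mono) auto
      then have "b * (1 - measure \<mu> {..<-y}) \<le> b * (1 - p)" using b by (intro mult_left_mono) auto
      then show "2 * (\<integral>t. V (y + t) \<partial>\<mu>) + b * (1 - measure \<mu> {..<-y}) \<le> 2 * V y + b - 1"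
        using near[of y] b by (simp add: algebra_simps)
    qed
    finally have *: "(\<integral>\<^sup>+t. ennreal (2 * V (y + t) + b) * indicator {0..} (y + t) \<partial>\<mu>) \<le>
        ennreal (2 * V y + b - 1)" .
    have "p \<le> 1" by (simp add: p_def)
    then have "b * p \<le> b * 1" using b(1) by (intro mult_left_mono) auto
    then have "b \<ge> 1" using b(2) EV by simp
    have "1 + (\<integral>\<^sup>+t. ennreal (2 * V (y + t) + b) * indicator {0..} (y + t) \<partial>\<mu>) \<le>
          ennreal 1 + ennreal (2 * V y + b - 1)"
      using * by (simp add: add_left_mono)
    also have "\<dots> = ennreal (1 + (2 * V y + b - 1))"
      using \<open>b \<ge> 1\<close> V_nonneg[of y] by (intro ennreal_plus[symmetric]) linarith+
    also have "1 + (2 * V y + b - 1) = 2 * V y + b" by simp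
    finally show "1 + (\<integral>\<^sup>+t. ennreal (2 * V (y + t) + b) * indicator {0..} (y + t) \<partial>\<mu>) \<le>
        ennreal (2 * V y + b)" .
  qed (use b in auto)
qed

end

section \<open>Subexponentiality relative to the law of the increments\<close>

lemma (in real_distribution) interval_measure_cdf: "interval_measure (cdf M) = M"
proof (rule cdf_unique)
  show "real_distribution M" ..
  have F: "\<And>x y. x \<le> y \<Longrightarrow> cdf M x \<le> cdf M y" "\<And>a. continuous (at_right a) (cdf M)"
    "(cdf M \<longlongrightarrow> 0) at_bot" "(cdf M \<longlongrightarrow> 1) at_top"
    using cdf_nondecreasing cdf_is_right_cont cdf_lim_at_bot cdf_lim_at_top_prob by auto
  show "real_distribution (interval_measure (cdf M))"
    by (rule real_distribution_interval_measure) (use F in auto)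
  show "cdf (interval_measure (cdf M)) = cdf M"
    by (rule cdf_interval_measure) (use F in auto)
qed

text \<open>
  The condition \<open>G\<^sub>1 \<in> S_F\<close> for the law of an increment. It implies that the tail of the law is
  positive everywhere, and hence that \<open>K > 0\<close>.
\<close>

locale subexponential_law = heavy_left_law +
  assumes G1_class_S: "G1 (cdf \<mu>) m \<in> class_S (cdf \<mu>)"
begin

definition T :: "real \<Rightarrow> real" where
  "T x = measure \<mu> {x<..}"

lemma tail_cdf: "tail (cdf \<mu>) x = T x"
proof -
  have "{x<..} = UNIV - {..x}" by auto
  then show ?thesis using prob_compl[of "{..x}"] by (simp add: tail_def T_def cdf_def)
qed

lemma T_pos [simp]: "T x > 0"
  using G1_class_S by (auto simp: class_S_def tail_cdf)

lemma T_nonzero [simp]: "T x \<noteq> 0"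
  using T_pos[of x] by linarith

lemma T_antimono: "x \<le> y \<Longrightarrow> T y \<le> T x"
  unfolding T_def by (intro finite_measure_mono) auto

lemma T_le_1: "T x \<le> 1"
  by (simp add: T_def)

lemma T_Ioc: "x \<le> y \<Longrightarrow> measure \<mu> {x<..y} = T x - T y"
proof -
  assume "x \<le> y"
  then have "{x<..y} = {x<..} - {y<..}" by auto
  then show ?thesis using \<open>x \<le> y\<close> by (simp add: T_def finite_measure_Diff)
qed

lemma T_measurable [measurable]: "T \<in> borel_measurable borel"
  using borel_measurable_mono[of "\<lambda>x. - T x"] T_antimono by (auto simp: mono_def)

definition G :: "real \<Rightarrow> real" where
  "G = G1 (cdf \<mu>) m"

definition K :: real where
  "K = (\<integral>t. g t \<partial>\<mu>)"

lemma integrable_g_shift: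
  assumes "x \<ge> 0"
  shows "integrable \<mu> (\<lambda>t. g (t - x))"
  by (rule Bochner_Integration.integrable_bound[OF g_integrable])
     (use assms in \<open>auto intro!: g_mono\<close>)

lemma integral_g_shift_pos:
  assumes "x \<ge> 0"
  shows "(\<integral>t. g (t - x) \<partial>\<mu>) > 0"
proof (rule ccontr)
  assume "\<not> (\<integral>t. g (t - x) \<partial>\<mu>) > 0"
  moreover have "(\<integral>t. g (t - x) \<partial>\<mu>) \<ge> 0" by (rule Bochner_Integration.integral_nonneg) simp
  ultimately have "(\<integral>t. g (t - x) \<partial>\<mu>) = 0" by simp
  then have "AE t in \<mu>. g (t - x) = 0"
    by (subst (asm) integral_nonneg_eq_0_iff_AE[OF integrable_g_shift[OF assms]]) auto
  then have "AE t in \<mu>. t \<notin> {x<..}"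
  proof eventually_elim
    fix t assume "g (t - x) = 0"
    then show "t \<notin> {x<..}" using m_pos[of "t - x"] by (auto simp: g_def split: if_splits)
  qed
  then have "T x = 0" unfolding T_def
    by (subst (asm) prob_eq_0[symmetric]) auto
  then show False using T_pos[of x] by simp
qed

lemma K_pos: "K > 0"
  using integral_g_shift_pos[of 0] by (simp add: K_def)

lemma K_const_eq: "enn2real (K_const (cdf \<mu>) m) = K"
proof -
  have "K_const (cdf \<mu>) m = (\<integral>\<^sup>+t. ennreal (g t) \<partial>\<mu>)"
    unfolding K_const_def interval_measure_cdf
    by (intro nn_integral_cong) (auto simp: g_def indicator_def)
  also have "\<dots> = ennreal K"
    unfolding K_def by (rule nn_integral_eq_integral[OF g_integrable]) simp
  finally show ?thesis using K_pos by simp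
qed

lemma G_eq:
  assumes "x \<ge> 0"
  shows "G x = 1 - (\<integral>t. g (t - x) \<partial>\<mu>) / K"
proof -
  have "(LINT t:{x<..}|\<mu>. (t - x) / m (t - x)) = (\<integral>t. g (t - x) \<partial>\<mu>)"
    unfolding set_lebesgue_integral_def
    by (intro Bochner_Integration.integral_cong) (auto simp: g_def indicator_def)
  then show ?thesis using assms by (simp add: G_def G1_def interval_measure_cdf K_const_eq)
qed

lemma G_neg: "x < 0 \<Longrightarrow> G x = 0"
  by (simp add: G_def G1_def)

lemma G_less_1: "x \<ge> 0 \<Longrightarrow> G x < 1"
  using G_eq integral_g_shift_pos K_pos by simp

lemma G_distribution: "mono G" "continuous (at_right a) G" "(G \<longlongrightarrow> 0) at_bot" "(G \<longlongrightarrow> 1) at_top"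
  using G1_class_S by (auto simp: class_S_def distribution_function_def G_def)

lemma G_increment:
  assumes "0 \<le> t" "t \<le> x"
  shows "K * (G x - G (x - t)) = (\<integral>u. g (u - x + t) - g (u - x) \<partial>\<mu>)"
proof -
  have "(\<integral>u. g (u - x + t) - g (u - x) \<partial>\<mu>) = (\<integral>u. g (u - (x - t)) \<partial>\<mu>) - (\<integral>u. g (u - x) \<partial>\<mu>)"
    using integrable_g_shift[of "x - t"] integrable_g_shift[of x] assms
    by (subst Bochner_Integration.integral_diff[symmetric]) (auto simp: algebra_simps)
  then show ?thesis using assms G_eq[of x] G_eq[of "x - t"] K_pos by (simp add: field_simps)
qed

text \<open>
  The mean decrease of \<open>1 - G\<close>, seen from \<open>x - \<xi>\<close> to \<open>x\<close>, over the steps \<open>\<xi> \<in> (0,x]\<close>. In terms of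
  independent \<open>U\<close> and \<open>\<xi>\<close> with distribution functions \<open>G\<close> and \<open>F\<close> it is
  \<open>P(U \<le> x, \<xi> \<le> x, U + \<xi> > x)\<close>, which is how it arises from the convolution.
\<close>

definition \<psi> :: "real \<Rightarrow> real" where
  "\<psi> x = (\<integral>t. (G x - G (x - t)) * indicator {0<..x} t \<partial>\<mu>)"

lemma G_measurable [measurable]: "G \<in> borel_measurable borel"
  by (rule borel_measurable_mono[OF G_distribution(1)])

lemma G_bounds: "0 \<le> G x" "G x \<le> 1"
proof -
  show "0 \<le> G x"
    using monoD[OF G_distribution(1), of "min x (-1)" x] G_neg[of "min x (-1)"] by simp
  show "G x \<le> 1" using G_less_1[of x] G_neg[of x] by (cases "x \<ge> 0") auto
qed

lemma integrable_\<psi>: "integrable \<mu> (\<lambda>t. (G x - G (x - t)) * indicator {0<..x} t)"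
  by (rule integrable_bounded_borel[where B=1])
     (use G_bounds in \<open>auto simp: indicator_def abs_le_iff algebra_simps intro: add_increasing2 order.trans[of _ 1]\<close>)

text \<open>
  With \<open>U\<close> and \<open>\<xi>\<close> as above, the integral is \<open>P(U \<le> x, U + \<xi> > x)\<close>. The event \<open>\<xi> > x\<close> contributes
  \<open>G(x) T(x)\<close>, and the rest is \<open>\<psi>(x)\<close>.
\<close>

lemma convolution_split:
  assumes "x \<ge> 0"
  shows "(LINT u:{0..x}|interval_measure G. T (x - u)) = G x * T x + \<psi> x"
proof -
  define \<gamma> where "\<gamma> = interval_measure G"
  have mono: "\<And>x y. x \<le> y \<Longrightarrow> G x \<le> G y" using G_distribution(1) by (auto simp: mono_def)
  interpret \<gamma>: real_distribution \<gamma>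
    unfolding \<gamma>_def by (rule real_distribution_interval_measure) (use mono G_distribution in auto)
  interpret P: pair_prob_space \<gamma> \<mu> ..
  have cdf: "cdf \<gamma> = G"
    unfolding \<gamma>_def by (rule cdf_interval_measure) (use mono G_distribution in auto)
  have neg: "measure \<gamma> {..<0} = 0"
  proof (rule tendsto_unique)
    show "(cdf \<gamma> \<longlongrightarrow> measure \<gamma> {..<0}) (at_left 0)" by (rule \<gamma>.cdf_at_left)
    have "\<forall>\<^sub>F y in at_left 0. cdf \<gamma> y = 0"
      unfolding cdf by (auto simp: eventually_at_left_field G_neg intro: exI[of _ "-1"])
    then show "(cdf \<gamma> \<longlongrightarrow> 0) (at_left 0)" by (rule tendsto_eventually)
  qed simp
  have Icc: "measure \<gamma> {0..x} = G x"
  proof -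
    have "{0..x} = {..x} - {..<0}" by auto
    then have "measure \<gamma> {0..x} = measure \<gamma> {..x} - measure \<gamma> {..<0}"
      using assms by (simp add: \<gamma>.finite_measure_Diff subset_eq)
    then show ?thesis using neg cdf by (simp add: cdf_def fun_eq_iff)
  qed
  define h :: "real \<Rightarrow> real \<Rightarrow> real" where "h u t = (if 0 \<le> u \<and> u \<le> x \<and> t > x - u then 1 else 0)" for u t
  have h [measurable]: "(\<lambda>(u, t). h u t) \<in> borel_measurable (borel \<Otimes>\<^sub>M borel)"
    unfolding h_def by measurable
  have hi: "integrable (\<gamma> \<Otimes>\<^sub>M \<mu>) (\<lambda>(u, t). h u t)"
    by (rule P.integrable_const_bound[where B=1]) (auto simp: h_def)
  have "(LINT u:{0..x}|\<gamma>. T (x - u)) = (\<integral>u. (\<integral>t. h u t \<partial>\<mu>) \<partial>\<gamma>)"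
    unfolding set_lebesgue_integral_def
  proof (rule Bochner_Integration.integral_cong[OF refl])
    fix u
    have "(\<integral>t. h u t \<partial>\<mu>) = (\<integral>t. indicator {0..x} u * indicator {x - u<..} t \<partial>\<mu>)"
      by (intro Bochner_Integration.integral_cong) (auto simp: h_def indicator_def)
    then show "indicator {0..x} u *\<^sub>R T (x - u) = (\<integral>t. h u t \<partial>\<mu>)" by (simp add: T_def)
  qed
  also have "\<dots> = (\<integral>t. (\<integral>u. h u t \<partial>\<gamma>) \<partial>\<mu>)"
    by (rule P.Fubini_integral[OF hi, symmetric])
  also have "\<dots> = (\<integral>t. G x * indicator {x<..} t + (G x - G (x - t)) * indicator {0<..x} t \<partial>\<mu>)"
  proof (rule Bochner_Integration.integral_cong[OF refl])
    fix t
    consider "t > x" | "0 < t" "t \<le> x" | "t \<le> 0" using assms by linarith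
    then show "(\<integral>u. h u t \<partial>\<gamma>) = G x * indicator {x<..} t + (G x - G (x - t)) * indicator {0<..x} t"
    proof cases
      case 1
      have "(\<integral>u. h u t \<partial>\<gamma>) = (\<integral>u. indicator {0..x} u \<partial>\<gamma>)"
        by (intro Bochner_Integration.integral_cong) (use 1 in \<open>auto simp: h_def indicator_def\<close>)
      then show ?thesis using 1 Icc by simp
    next
      case 2
      have "(\<integral>u. h u t \<partial>\<gamma>) = (\<integral>u. indicator {x - t<..x} u \<partial>\<gamma>)"
        by (intro Bochner_Integration.integral_cong) (use 2 in \<open>auto simp: h_def indicator_def\<close>)
      also have "\<dots> = cdf \<gamma> x - cdf \<gamma> (x - t)"
        using \<gamma>.cdf_diff_eq[of "x - t" x] 2 by simp
      finally show ?thesis using 2 by (simp add: cdf)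
    next
      case 3
      have "h u t = 0" for u using 3 by (auto simp: h_def)
      then show ?thesis using 3 assms by simp
    qed
  qed
  also have "\<dots> = G x * T x + \<psi> x"
  proof -
    have "integrable \<mu> (\<lambda>t. G x * indicator {x<..} t)"
      by (intro integrable_mult_right integrable_bounded_borel[where B=1]) (auto simp: indicator_def)
    then show ?thesis
      unfolding \<psi>_def by (subst Bochner_Integration.integral_add[OF _ integrable_\<psi>]) (auto simp: T_def)
  qed
  finally show ?thesis by (simp add: \<gamma>_def)
qed

lemma \<psi>_negligible:
  assumes "\<delta> > 0"
  shows "\<forall>\<^sub>F x in at_top. \<psi> x \<le> \<delta> * T x"
proof -
  let ?C = "\<lambda>x. LINT u:{0..x}|interval_measure G. T (x - u)"
  have "?C \<sim>[at_top] T"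
    using G1_class_S by (simp add: class_S_def G_def tail_cdf[abs_def])
  then have "((\<lambda>x. ?C x / T x) \<longlongrightarrow> 1) at_top"
    by (rule asymp_equivD_strong) (auto intro!: always_eventually simp: less_imp_neq[symmetric])
  then have "((\<lambda>x. ?C x / T x - G x) \<longlongrightarrow> 1 - 1) at_top"
    by (intro tendsto_diff G_distribution)
  then have "\<forall>\<^sub>F x in at_top. ?C x / T x - G x < \<delta>"
    by (rule order_tendstoD(2)) (use assms in simp)
  with eventually_ge_at_top[of 0] show ?thesis
  proof eventually_elim
    case (elim x)
    then have "?C x - G x * T x < \<delta> * T x" using T_pos[of x] by (simp add: field_simps)
    then show ?case using convolution_split[of x] elim by simp
  qed
qed

text \<open>
  A step in \<open>(x - a, x]\<close> brings \<open>x - \<xi>\<close> below \<open>a\<close>, where \<open>1 - G\<close> is bounded away from \<open>0\<close>. So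
  \<open>\<psi>(x)\<close> is at least a constant times \<open>T(x - a) - T(x)\<close>.
\<close>

lemma long_tailed:
  assumes "a > 0" "\<delta> > 0"
  shows "\<forall>\<^sub>F x in at_top. T (x - a) \<le> (1 + \<delta>) * T x"
proof -
  define c where "c = (1 - G a) / 2"
  have c: "c > 0" using G_less_1[of a] assms by (simp add: c_def)
  have "\<forall>\<^sub>F x in at_top. G x > 1 - c"
    by (rule order_tendstoD(1)[OF G_distribution(4)]) (use c in simp)
  moreover have "\<forall>\<^sub>F x in at_top. \<psi> x \<le> (c * \<delta>) * T x"
    by (rule \<psi>_negligible) (use c assms in simp)
  ultimately show ?thesis using eventually_ge_at_top[of a]
  proof eventually_elim
    case (elim x)
    have "c * (T (x - a) - T x) = (\<integral>t. c * indicator {x - a<..x} t \<partial>\<mu>)"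
      using T_Ioc[of "x - a" x] assms by simp
    also have "\<dots> \<le> \<psi> x"
      unfolding \<psi>_def
    proof (intro integral_mono integrable_\<psi> integrable_mult_right integrable_bounded_borel[where B=1])
      fix t
      show "c * indicator {x - a<..x} t \<le> (G x - G (x - t)) * indicator {0<..x} t"
      proof (cases "t \<in> {x - a<..x}")
        case True
        then have "G (x - t) \<le> G a" by (intro monoD[OF G_distribution(1)]) auto
        moreover have "c \<le> G x - G a" using elim(1) by (simp add: c_def field_simps)
        ultimately show ?thesis using True elim(3) by simp
      next
        case False
        have "t \<in> {0<..x} \<Longrightarrow> G (x - t) \<le> G x" by (intro monoD[OF G_distribution(1)]) auto
        then show ?thesis using False by (auto simp: indicator_def)
      qed
    qed (auto simp: indicator_def)
    also have "\<dots> \<le> c * (\<delta> * T x)" using elim(2) by (simp add: mult.assoc)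
    finally have "T (x - a) - T x \<le> \<delta> * T x" using c by simp
    then show ?case by (simp add: algebra_simps)
  qed
qed

text \<open>
  The analogue of \<open>K (1 - G(z))\<close> in which \<open>V\<close> replaces \<open>g\<close>: unlike \<open>g\<close>, the function \<open>V\<close> has a
  drift that can be used.
\<close>

definition Q :: "real \<Rightarrow> real" where
  "Q z = (\<integral>u. V (u - z) \<partial>\<mu>)"

lemma integrable_Q: "integrable \<mu> (\<lambda>u. V (u - z))"
  using integrable_V_shift[of "\<lambda>u. u - z" "max (-z) 0"] by auto

lemma Q_nonneg: "Q z \<ge> 0"
  unfolding Q_def by (rule Bochner_Integration.integral_nonneg) simp

lemma Q_antimono: "z \<le> z' \<Longrightarrow> Q z' \<le> Q z"
  unfolding Q_def by (intro integral_mono integrable_Q) (auto intro!: V_mono)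

lemma Q_measurable [measurable]: "Q \<in> borel_measurable borel"
  using borel_measurable_mono[of "\<lambda>x. - Q x"] Q_antimono by (auto simp: mono_def)

text \<open>
  The analogue of \<open>\<psi>\<close> for \<open>Q\<close>: the mean gain of \<open>y \<mapsto> Q(x - y)\<close> through an upward step, where
  \<open>z = x - y\<close>.
\<close>

definition e :: "real \<Rightarrow> real" where
  "e z = (\<integral>t. (Q (z - t) - Q z) * indicator {0<..z} t \<partial>\<mu>)"

lemma integrable_e: "integrable \<mu> (\<lambda>t. (Q (z - t) - Q z) * indicator {0<..z} t)"
proof (rule integrable_bounded_borel[where B="Q 0"])
  fix t
  show "\<bar>(Q (z - t) - Q z) * indicator {0<..z} t\<bar> \<le> Q 0"
    using Q_antimono[of "z - t" z] Q_antimono[of 0 "z - t"] Q_nonneg[of z] Q_nonneg[of 0]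
    by (auto simp: indicator_def)
qed measurable

text \<open>
  Let \<open>u\<close> be the independent copy inside \<open>Q\<close> and \<open>t\<close> the step, and consider the increment
  \<open>V(u + t - z) - V(u - z)\<close>. If \<open>u \<le> z\<close>, the subtracted term and its counterpart for \<open>g\<close> both vanish,
  and \<open>V \<le> 14 g\<close> bounds the increment by that of \<open>14 g\<close>, which integrates to a multiple of \<open>\<psi>\<close>.
  A bound of \<open>V\<close> by \<open>g\<close> says nothing about increments if \<open>u > z\<close>, but there subadditivity and
  the decay of the slopes of \<open>V\<close> are enough.
\<close>

lemma e_le:
  assumes "R > 0"
  shows "e z \<le> 14 * K * \<psi> z + (\<integral>t. V t \<partial>\<mu>) * (T z - T (z + R)) + \<Phi> R * T z"
proof -
  let ?b = "\<lambda>t. min (V t) (14 * max t 0 / m R)"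
  have inc: "Q (z - t) - Q z \<le> 14 * (K * (G z - G (z - t))) + V t * (T z - T (z + R)) + ?b t * T z"
    if t: "t \<in> {0<..z}" for t
  proof -
    have int_g: "integrable \<mu> (\<lambda>u. g (u - z + t) - g (u - z))"
      using integrable_g_shift[of "z - t"] integrable_g_shift[of z] t
      by (intro Bochner_Integration.integrable_diff) (auto simp: algebra_simps)
    have int_ind: "integrable \<mu> (indicator A :: real \<Rightarrow> real)" if "A \<in> sets borel" for A
      using that by (intro integrable_bounded_borel[where B=1]) (auto simp: indicator_def)
    have ints: "integrable \<mu> (\<lambda>u. 14 * (g (u - z + t) - g (u - z)))"
        "integrable \<mu> (\<lambda>u. V t * indicator {z<..z + R} u)"
        "integrable \<mu> (\<lambda>u. ?b t * indicator {z + R<..} u)"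
      by (intro integrable_mult_right int_g int_ind; simp)+
    have "Q (z - t) - Q z = (\<integral>u. V (u - (z - t)) - V (u - z) \<partial>\<mu>)"
      unfolding Q_def by (intro Bochner_Integration.integral_diff[symmetric] integrable_Q)
    also have "\<dots> \<le> (\<integral>u. 14 * (g (u - z + t) - g (u - z)) + V t * indicator {z<..z + R} u
                        + ?b t * indicator {z + R<..} u \<partial>\<mu>)"
    proof (intro integral_mono Bochner_Integration.integrable_diff integrable_Q
        Bochner_Integration.integrable_add ints)
      fix u
      have eq: "u - (z - t) = (u - z) + t" by simp
      have g: "g (u - z) \<le> g (u - z + t)" using t by (intro g_mono) auto
      consider "u \<le> z" | "z < u" "u \<le> z + R" | "z + R < u" by linarith
      then show "V (u - (z - t)) - V (u - z) \<le> 14 * (g (u - z + t) - g (u - z)) +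
          V t * indicator {z<..z + R} u + ?b t * indicator {z + R<..} u"
      proof cases
        case 1
        then have "g (u - z) = 0" by (simp add: g_def)
        then show ?thesis using 1 assms V_le_g[of "u - z + t"] by (simp add: eq)
      next
        case 2
        then show ?thesis using V_subadditive[of t "u - z"] t g by (simp add: eq)
      next
        case 3
        then have "V (u - z + t) - V (u - z) \<le> ?b t"
          using V_increment_le_min[OF assms, of "u - z" t] t by (simp add: max_def)
        moreover have ind: "indicator {z<..z + R} u = (0::real)" "indicator {z + R<..} u = (1::real)"
          using 3 by auto
        ultimately show ?thesis
          using g unfolding eq ind mult_1_right by (intro add_increasing) simp_all
      qed
    qed
    also have "\<dots> = 14 * (K * (G z - G (z - t))) + V t * (T z - T (z + R)) + ?b t * T (z + R)"
    proof -
      have "(\<integral>u. 14 * (g (u - z + t) - g (u - z)) \<partial>\<mu>) = 14 * (K * (G z - G (z - t)))"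
        using G_increment[of t z] t by (subst integral_mult_right_zero) simp
      moreover have "(\<integral>u. V t * indicator {z<..z + R} u \<partial>\<mu>) = V t * (T z - T (z + R))"
        using T_Ioc[of z "z + R"] assms by simp
      moreover have "(\<integral>u. ?b t * indicator {z + R<..} u \<partial>\<mu>) = ?b t * T (z + R)"
        by (simp add: T_def)
      ultimately show ?thesis
        by (simp only: Bochner_Integration.integral_add Bochner_Integration.integrable_add ints)
    qed
    also have "?b t * T (z + R) \<le> ?b t * T z"
      using min_V_bounds(1)[OF assms, of t] assms by (intro mult_left_mono T_antimono) auto
    finally show ?thesis by simp
  qed
  have i1: "integrable \<mu> (\<lambda>t. 14 * K * ((G z - G (z - t)) * indicator {0<..z} t))"
    by (intro integrable_mult_right integrable_\<psi>)
  have i2: "integrable \<mu> (\<lambda>t. V t * (T z - T (z + R)))"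
    by (intro integrable_mult_left V_integrable)
  have i3: "integrable \<mu> (\<lambda>t. ?b t * T z)"
    by (intro integrable_mult_left integrable_\<Phi> assms)
  have "e z \<le> (\<integral>t. 14 * K * ((G z - G (z - t)) * indicator {0<..z} t) + V t * (T z - T (z + R)) +
               ?b t * T z \<partial>\<mu>)"
    unfolding e_def
  proof (intro integral_mono integrable_e Bochner_Integration.integrable_add i1 i2 i3)
    fix t
    have "V t * (T z - T (z + R)) \<ge> 0" "?b t * T z \<ge> 0"
      using assms min_V_bounds(1)[OF assms, of t] T_antimono[of z "z + R"] T_pos[of z]
      by (auto intro!: mult_nonneg_nonneg simp del: T_pos min_less_iff_conj)
    then show "(Q (z - t) - Q z) * indicator {0<..z} t \<le>
        14 * K * ((G z - G (z - t)) * indicator {0<..z} t) + V t * (T z - T (z + R)) + ?b t * T z"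
      using inc[of t] by (cases "t \<in> {0<..z}") (simp_all add: mult.assoc)
  qed
  also have "\<dots> = 14 * K * \<psi> z + (\<integral>t. V t \<partial>\<mu>) * (T z - T (z + R)) + \<Phi> R * T z"
    using i1 i2 i3 by (simp add: Bochner_Integration.integral_add Bochner_Integration.integrable_add
        \<psi>_def \<Phi>_def)
  finally show ?thesis .
qed

text \<open>
  In \<open>e_le\<close> the first term is controlled by \<open>G\<^sub>1 \<in> S_F\<close>, the second by long-tailedness for fixed
  \<open>R\<close>, and the third by the choice of a large \<open>R\<close>.
\<close>

lemma e_negligible:
  assumes "\<delta> > 0"
  shows "\<forall>\<^sub>F z in at_top. e z \<le> \<delta> * T z"
proof -
  have "\<forall>\<^sub>F R in at_top. \<Phi> R < \<delta> / 3 \<and> R > 0"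
    by (intro eventually_conj order_tendstoD(2)[OF \<Phi>_tendsto_0] eventually_gt_at_top) (use assms in simp)
  then obtain R where R: "\<Phi> R < \<delta> / 3" "R > 0" by (auto simp: eventually_at_top_linorder)
  define E where "E = (\<integral>t. V t \<partial>\<mu>) + 1"
  have E: "E > 0" unfolding E_def by (intro add_nonneg_pos Bochner_Integration.integral_nonneg) auto
  have "\<forall>\<^sub>F x in at_top. T (x - R) \<le> (1 + \<delta> / (3 * E)) * T x"
    by (rule long_tailed) (use R E assms in auto)
  then obtain x0 where x0: "\<And>x. x \<ge> x0 \<Longrightarrow> T (x - R) \<le> (1 + \<delta> / (3 * E)) * T x"
    by (auto simp: eventually_at_top_linorder)
  have "T (z + R - R) \<le> (1 + \<delta> / (3 * E)) * T (z + R)" if "z \<ge> x0" for z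
    using x0[of "z + R"] R that by simp
  then have "\<forall>\<^sub>F z in at_top. T (z + R - R) \<le> (1 + \<delta> / (3 * E)) * T (z + R)"
    by (auto simp: eventually_at_top_linorder)
  moreover have "\<forall>\<^sub>F z in at_top. \<psi> z \<le> \<delta> / (42 * K) * T z"
    by (rule \<psi>_negligible) (use K_pos assms in simp)
  ultimately show ?thesis
  proof eventually_elim
    case (elim z)
    have "T z - T (z + R) \<le> \<delta> / (3 * E) * T (z + R)" using elim(1) by (simp add: algebra_simps)
    also have "\<dots> \<le> \<delta> / (3 * E) * T z"
      using assms E R by (intro mult_left_mono T_antimono) auto
    finally have d: "T z - T (z + R) \<le> \<delta> / (3 * E) * T z" .
    have "(\<integral>t. V t \<partial>\<mu>) * (T z - T (z + R)) \<le> E * (T z - T (z + R))"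
      using T_antimono[of z "z + R"] R by (intro mult_right_mono) (auto simp: E_def)
    also have "\<dots> \<le> E * (\<delta> / (3 * E) * T z)" using d E by (intro mult_left_mono) auto
    also have "\<dots> = \<delta> / 3 * T z" using E by simp
    finally have 2: "(\<integral>t. V t \<partial>\<mu>) * (T z - T (z + R)) \<le> \<delta> / 3 * T z" .
    have "14 * K * \<psi> z \<le> 14 * K * (\<delta> / (42 * K) * T z)"
      using elim(2) K_pos by (intro mult_left_mono) auto
    also have "\<dots> = \<delta> / 3 * T z" using K_pos by simp
    finally have 1: "14 * K * \<psi> z \<le> \<delta> / 3 * T z" .
    have 3: "\<Phi> R * T z \<le> \<delta> / 3 * T z"
      using R T_pos[of z] by (intro mult_right_mono) (auto simp: less_imp_le)
    have "e z \<le> \<delta> / 3 * T z + \<delta> / 3 * T z + \<delta> / 3 * T z"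
      using e_le[OF R(2), of z] 1 2 3 by linarith
    then show ?case by simp
  qed
qed

text \<open>
  The one-step drift of \<open>y \<mapsto> Q(z) - Q(x')\<close>, \<open>z = x' - y\<close>, for the walk killed outside \<open>[0,x]\<close>. A
  downward step, cut off at \<open>0\<close>, replaces \<open>u - z\<close> by \<open>u - z - min \<xi>\<^sup>- y\<close> inside \<open>V\<close>; by
  \<open>V_drift_truncated\<close> this costs \<open>1\<close> for each \<open>u \<in> (z,x']\<close>, which is \<open>T(z) - T(x')\<close> in total.
  Upward steps give back at most \<open>e(z)\<close>. The offset \<open>d\<close> between \<open>x\<close> and the reference level \<open>x'\<close>
  keeps \<open>z \<ge> d\<close> all the way up to \<open>y = x\<close>, so that asymptotic bounds for \<open>e(z)\<close> apply on all of
  \<open>[0,x]\<close>.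
\<close>

lemma Q_drift:
  assumes "0 \<le> y" "y \<le> x" "0 \<le> d"
  defines "x' \<equiv> x + d" and "z \<equiv> x + d - y"
  shows "integrable \<mu> (\<lambda>t. (Q (z - t) - Q x') * indicator {-y..x - y} t)"
    and "(\<integral>t. (Q (z - t) - Q x') * indicator {-y..x - y} t \<partial>\<mu>) \<le> Q z - Q x' - (T z - T x') + e z"
proof -
  interpret P: pair_prob_space \<mu> \<mu> ..
  have z: "z \<ge> 0" "z + y = x'" "z \<le> x'" using assms by (auto simp: x'_def z_def)
  let ?k = "\<lambda>t. z + min (neg_part t) y"
  have Q_bound: "\<bar>Q (?k t)\<bar> \<le> Q 0" for t
    using Q_antimono[of 0 "?k t"] Q_nonneg[of "?k t"] z assms by auto
  have int_Qk: "integrable \<mu> (\<lambda>t. Q (?k t))"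
    by (rule integrable_bounded_borel[OF _ Q_bound]) measurable
  have "integrable (\<mu> \<Otimes>\<^sub>M \<mu>) (\<lambda>(t, u). V (u - ?k t))"
  proof (rule P.Fubini_integrable)
    show "integrable \<mu> (\<lambda>t. \<integral>u. norm (case (t, u) of (t, u) \<Rightarrow> V (u - ?k t)) \<partial>\<mu>)"
      using int_Qk by (simp add: Q_def)
    show "AE t in \<mu>. integrable \<mu> (\<lambda>u. case (t, u) of (t, u) \<Rightarrow> V (u - ?k t))"
      by (auto intro: integrable_Q)
  qed measurable
  then have swap: "(\<integral>t. Q (?k t) \<partial>\<mu>) = (\<integral>u. (\<integral>t. V ((u - z) - min (neg_part t) y) \<partial>\<mu>) \<partial>\<mu>)"
       and int_swap: "integrable \<mu> (\<lambda>u. \<integral>t. V ((u - z) - min (neg_part t) y) \<partial>\<mu>)"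
    using P.Fubini_integral[of "\<lambda>t u. V (u - ?k t)"] P.integrable_snd[of "\<lambda>t u. V (u - ?k t)"]
    by (simp_all add: Q_def diff_diff_eq)
  have int_ind: "integrable \<mu> (\<lambda>u. indicator {0<..y} (u - z) :: real)"
    by (rule integrable_bounded_borel[where B=1]) (auto simp: indicator_def)
  have "(\<integral>t. Q (?k t) \<partial>\<mu>) \<le>
      (\<integral>u. V (u - z) - indicator {0<..y} (u - z) \<partial>\<mu>)"
    unfolding swap
    by (intro integral_mono Bochner_Integration.integrable_diff integrable_Q int_ind int_swap
          V_drift_truncated assms)
  also have "\<dots> = Q z - (\<integral>u. indicator {z<..x'} u \<partial>\<mu>)"
  proof -
    have "(\<lambda>u. indicator {0<..y} (u - z) :: real) = indicator {z<..x'}"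
      using z by (auto simp: indicator_def fun_eq_iff)
    then show ?thesis
      using int_ind by (simp add: Bochner_Integration.integral_diff integrable_Q Q_def)
  qed
  also have "\<dots> = Q z - (T z - T x')" using T_Ioc[of z x'] z by simp
  finally have down: "(\<integral>t. Q (?k t) \<partial>\<mu>) \<le> Q z - (T z - T x')" .
  show int: "integrable \<mu> (\<lambda>t. (Q (z - t) - Q x') * indicator {-y..x - y} t)"
  proof (rule integrable_bounded_borel[where B="Q 0"])
    fix t
    show "\<bar>(Q (z - t) - Q x') * indicator {-y..x - y} t\<bar> \<le> Q 0"
    proof (cases "t \<in> {-y..x - y}")
      case True
      then have "0 \<le> z - t" "z - t \<le> x'" using assms z by (auto simp: x'_def z_def)
      then show ?thesis
        using Q_antimono[of 0 "z - t"] Q_antimono[of "z - t" x'] Q_nonneg[of x'] True by simp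
    qed (simp add: Q_nonneg)
  qed measurable
  have "(\<integral>t. (Q (z - t) - Q x') * indicator {-y..x - y} t \<partial>\<mu>) \<le>
        (\<integral>t. (Q (?k t) - Q x') + (Q (z - t) - Q z) * indicator {0<..z} t \<partial>\<mu>)"
  proof (intro integral_mono int Bochner_Integration.integrable_add
      Bochner_Integration.integrable_diff int_Qk integrable_e)
    fix t
    have 1: "Q (?k t) - Q x' \<ge> 0" using Q_antimono[of "?k t" x'] z assms by auto
    have 2: "(Q (z - t) - Q z) * indicator {0<..z} t \<ge> 0"
      using Q_antimono[of "z - t" z] by (auto simp: indicator_def)
    show "(Q (z - t) - Q x') * indicator {-y..x - y} t \<le>
        (Q (?k t) - Q x') + (Q (z - t) - Q z) * indicator {0<..z} t"
    proof (cases "t \<in> {-y..x - y}")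
      case True
      show ?thesis
      proof (cases "t > 0")
        case pos: True
        then have "t \<in> {0<..z}" "?k t = z"
          using True assms by (auto simp: z_def neg_part_def)
        then show ?thesis using True by simp
      next
        case False
        then have "?k t = z - t" using True by (auto simp: neg_part_def)
        then show ?thesis using 2 True by simp
      qed
    next
      case False
      then show ?thesis using 1 2 by simp
    qed
  qed auto
  also have "\<dots> = (\<integral>t. Q (?k t) \<partial>\<mu>) - Q x' + e z"
    using int_Qk integrable_e[of z] by (simp add: Bochner_Integration.integral_add e_def)
  finally show "(\<integral>t. (Q (z - t) - Q x') * indicator {-y..x - y} t \<partial>\<mu>) \<le> Q z - Q x' - (T z - T x') + e z"
    using down by simp
qed

text \<open>
  The function is \<open>W(y) = \<kappa> (Q(x' - y) - Q(x'))\<close> with \<open>x' = x + d\<close>. By \<open>Q_drift\<close> its expected loss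
  at \<open>y\<close> is at least \<open>\<kappa> (T(z) - T(x') - e(z))\<close> with \<open>z = x' - y\<close>. For \<open>y > A\<close> the main term
  \<open>\<kappa> T(z)\<close> pays for \<open>T(x - y)\<close>, and the rest is at worst \<open>-\<kappa> T(x)\<close>. For \<open>y \<le> A\<close> the loss may be
  ignored except for its error \<open>\<kappa> e(z)\<close>, because \<open>T(x - y)\<close> is itself close to \<open>T(x)\<close>. It matters
  that \<open>\<kappa>\<close> is chosen before \<open>A\<close>.
\<close>

lemma supersolution_interval:
  assumes \<epsilon>: "0 < \<epsilon>" "\<epsilon> \<le> 1"
  obtains \<kappa> where "\<kappa> \<ge> 0"
    "\<And>A. A > 0 \<Longrightarrow> \<forall>\<^sub>F x in at_top. \<exists>W. W \<in> borel_measurable borel \<and> W 0 = 0 \<and>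
       (\<forall>y\<in>{0..x}. ennreal (T (x - y)) + (\<integral>\<^sup>+t. W (y + t) * indicator {0..x} (y + t) \<partial>\<mu>) \<le>
          W y + ennreal (T x * (1 + \<epsilon> + \<kappa> * indicator {A<..} y)))"
proof -
  have "\<forall>\<^sub>F z in at_top. e z \<le> 1 / 2 * T z \<and> z > 0"
    by (intro eventually_conj e_negligible eventually_gt_at_top) simp
  then obtain d0 where d0: "\<And>z. z \<ge> d0 \<Longrightarrow> e z \<le> 1 / 2 * T z \<and> z > 0"
    by (auto simp: eventually_at_top_linorder)
  \<comment> \<open>at distance at least \<open>d\<close>, half of the main term \<open>T(z)\<close> survives the error \<open>e(z)\<close>\<close>
  define d where "d = max d0 1"
  have d: "d > 0" "\<And>z. z \<ge> d \<Longrightarrow> e z \<le> 1 / 2 * T z" using d0 by (auto simp: d_def)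
  have "\<forall>\<^sub>F z in at_top. T (z - d) \<le> (1 + 1) * T z"
    by (rule long_tailed) (use d in auto)
  then obtain z1 where z1: "\<And>z. z \<ge> z1 \<Longrightarrow> T (z - d) \<le> 2 * T z"
    by (auto simp: eventually_at_top_linorder)
  \<comment> \<open>a bound for \<open>T(z - d) / T(z)\<close> that is valid for all \<open>z\<close>, not only for large ones\<close>
  define C where "C = max 2 (1 / T z1)"
  have C: "T (z - d) \<le> C * T z" for z
  proof (cases "z \<ge> z1")
    case True
    then have "T (z - d) \<le> 2 * T z" by (rule z1)
    also have "\<dots> \<le> C * T z" by (intro mult_right_mono) (auto simp: C_def less_imp_le)
    finally show ?thesis .
  next
    case False
    have "T (z - d) \<le> 1 / T z1 * T z1" using T_le_1 by simp
    also have "\<dots> \<le> 1 / T z1 * T z" using False by (intro mult_left_mono T_antimono) (auto simp: less_imp_le)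
    also have "\<dots> \<le> C * T z" by (intro mult_right_mono) (auto simp: C_def less_imp_le)
    finally show ?thesis .
  qed
  \<comment> \<open>the factor \<open>2\<close> compensates the half of \<open>T(z)\<close> that is given up to \<open>e(z)\<close>\<close>
  define \<kappa> where "\<kappa> = 2 * C"
  have \<kappa>: "\<kappa> > 0" by (auto simp: \<kappa>_def C_def)
  show thesis
  proof (rule that)
    show "\<kappa> \<ge> 0" using \<kappa> by simp
    fix A :: real assume A: "A > 0"
    have "\<forall>\<^sub>F z in at_top. e z \<le> \<epsilon> / (4 * \<kappa>) * T z"
      by (rule e_negligible) (use \<epsilon> \<kappa> in simp)
    then obtain z2 where z2: "\<And>z. z \<ge> z2 \<Longrightarrow> e z \<le> \<epsilon> / (4 * \<kappa>) * T z"
      by (auto simp: eventually_at_top_linorder)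
    have "\<forall>\<^sub>F x in at_top. T (x - A) \<le> (1 + \<epsilon> / 4) * T x"
      by (rule long_tailed) (use A \<epsilon> in auto)
    with eventually_ge_at_top[of "z2 + A"]
    show "\<forall>\<^sub>F x in at_top. \<exists>W. W \<in> borel_measurable borel \<and> W 0 = 0 \<and>
       (\<forall>y\<in>{0..x}. ennreal (T (x - y)) + (\<integral>\<^sup>+t. W (y + t) * indicator {0..x} (y + t) \<partial>\<mu>) \<le>
          W y + ennreal (T x * (1 + \<epsilon> + \<kappa> * indicator {A<..} y)))"
    proof eventually_elim
      case (elim x)
      define W where "W y = ennreal (\<kappa> * (Q (x + d - y) - Q (x + d)))" for y
      have "ennreal (T (x - y)) + (\<integral>\<^sup>+t. W (y + t) * indicator {0..x} (y + t) \<partial>\<mu>) \<le>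
          W y + ennreal (T x * (1 + \<epsilon> + \<kappa> * indicator {A<..} y))" if y: "y \<in> {0..x}" for y
      proof -
        define z where "z = x + d - y"
        have z: "z \<ge> d" "z \<le> x + d" "x - y = z - d" using y by (auto simp: z_def)
        define I where "I = (\<integral>t. (Q (z - t) - Q (x + d)) * indicator {-y..x - y} t \<partial>\<mu>)"
        have int: "integrable \<mu> (\<lambda>t. (Q (z - t) - Q (x + d)) * indicator {-y..x - y} t)"
          and I: "I \<le> Q z - Q (x + d) - (T z - T (x + d)) + e z"
          unfolding I_def z_def using Q_drift[of y x d] y d by auto
        have nonneg: "0 \<le> (Q (z - t) - Q (x + d)) * indicator {-y..x - y} t" for t
          using Q_antimono[of "z - t" "x + d"] by (auto simp: indicator_def z_def)
        have I_nonneg: "I \<ge> 0"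
          unfolding I_def by (rule Bochner_Integration.integral_nonneg[OF nonneg])
        have "(\<integral>\<^sup>+t. W (y + t) * indicator {0..x} (y + t) \<partial>\<mu>) =
            (\<integral>\<^sup>+t. ennreal (\<kappa> * ((Q (z - t) - Q (x + d)) * indicator {-y..x - y} t)) \<partial>\<mu>)"
          by (intro nn_integral_cong) (auto simp: W_def z_def indicator_def algebra_simps)
        also have "\<dots> = ennreal (\<kappa> * I)"
          unfolding I_def using int nonneg \<kappa>
          by (subst nn_integral_eq_integral) (auto intro!: mult_nonneg_nonneg)
        finally have W_int: "(\<integral>\<^sup>+t. W (y + t) * indicator {0..x} (y + t) \<partial>\<mu>) = ennreal (\<kappa> * I)" .
        have W_y: "W y = ennreal (\<kappa> * (Q z - Q (x + d)))" by (simp add: W_def z_def)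
        have QQ: "Q z - Q (x + d) \<ge> 0" using Q_antimono z by simp
        have \<kappa>I: "\<kappa> * I \<le> \<kappa> * (Q z - Q (x + d)) + \<kappa> * (e z - (T z - T (x + d)))"
          using mult_left_mono[OF I, of \<kappa>] \<kappa> by (simp add: algebra_simps)
        have "T (x - y) + \<kappa> * I \<le> \<kappa> * (Q z - Q (x + d)) + T x * (1 + \<epsilon> + \<kappa> * indicator {A<..} y)"
        proof (cases "y > A")
          case True
          have "e z - (T z - T (x + d)) \<le> T x - 1 / 2 * T z"
            using d(2)[OF z(1)] T_antimono[of x "x + d"] d(1) by simp
          then have "\<kappa> * (e z - (T z - T (x + d))) \<le> \<kappa> * (T x - 1 / 2 * T z)"
            using \<kappa> by (intro mult_left_mono) auto
          moreover have "T (x - y) \<le> \<kappa> * (1 / 2 * T z)" using C[of z] z by (simp add: \<kappa>_def)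
          moreover have "0 \<le> T x * (1 + \<epsilon>)" using \<epsilon> by (simp add: less_imp_le)
          ultimately show ?thesis using \<kappa>I True by (simp add: algebra_simps)
        next
          case False
          have zA: "z \<ge> x - A" "z \<ge> z2" using False elim(1) d by (auto simp: z_def)
          have "e z - (T z - T (x + d)) \<le> \<epsilon> / (4 * \<kappa>) * T (x - A)"
          proof -
            have "e z \<le> \<epsilon> / (4 * \<kappa>) * T z" by (rule z2[OF zA(2)])
            also have "\<dots> \<le> \<epsilon> / (4 * \<kappa>) * T (x - A)"
              using zA \<epsilon> \<kappa> by (intro mult_left_mono T_antimono) auto
            finally show ?thesis using T_antimono[OF z(2)] by simp
          qed
          then have "\<kappa> * (e z - (T z - T (x + d))) \<le> \<kappa> * (\<epsilon> / (4 * \<kappa>) * T (x - A))"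
            using \<kappa> by (intro mult_left_mono) auto
          also have "\<dots> = \<epsilon> / 4 * T (x - A)" using \<kappa> by simp
          finally have 1: "\<kappa> * (e z - (T z - T (x + d))) \<le> \<epsilon> / 4 * T (x - A)" .
          have 2: "T (x - y) \<le> T (x - A)" using False by (intro T_antimono) simp
          have "(1 + \<epsilon> / 4) * T (x - A) \<le> (1 + \<epsilon> / 4) * ((1 + \<epsilon> / 4) * T x)"
            using elim(2) \<epsilon> by (intro mult_left_mono) auto
          also have "\<dots> = (1 + \<epsilon> / 4) * (1 + \<epsilon> / 4) * T x" by simp
          also have "\<dots> \<le> (1 + \<epsilon>) * T x"
          proof (intro mult_right_mono)
            have "\<epsilon> * \<epsilon> \<le> \<epsilon>" using \<epsilon> mult_left_mono[of \<epsilon> 1 \<epsilon>] by simp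
            moreover have "(1 + \<epsilon> / 4) * (1 + \<epsilon> / 4) = 1 + \<epsilon> / 2 + \<epsilon> * \<epsilon> / 16"
              by (simp add: algebra_simps)
            ultimately show "(1 + \<epsilon> / 4) * (1 + \<epsilon> / 4) \<le> 1 + \<epsilon>" using \<epsilon> by linarith
          qed (simp add: less_imp_le)
          finally show ?thesis using \<kappa>I 1 2 False by (simp add: algebra_simps)
        qed
        moreover have "0 \<le> T x * (1 + \<epsilon> + \<kappa> * indicator {A<..} y)"
          using \<epsilon> \<kappa> by (intro mult_nonneg_nonneg) (auto simp: less_imp_le indicator_def)
        ultimately show ?thesis
          unfolding W_int W_y using \<kappa> QQ I_nonneg
          by (simp add: ennreal_plus[symmetric] less_imp_le ennreal_leI del: ennreal_plus)
      qed
      moreover have "W \<in> borel_measurable borel" unfolding W_def by measurable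
      moreover have "W 0 = 0" by (simp add: W_def)
      ultimately show ?case by blast
    qed
  qed
qed

end

section \<open>Occupation sums of a random walk before it leaves a set\<close>

locale iid_walk = prob_space M for M :: "'a measure" +
  fixes \<xi> :: "nat \<Rightarrow> 'a \<Rightarrow> real" and \<mu> :: "real measure"
  assumes indep: "indep_vars (\<lambda>_. borel) \<xi> UNIV"
    and law: "\<And>n. distr M borel (\<xi> n) = \<mu>"
begin

lemma increment_measurable [measurable]: "\<xi> n \<in> borel_measurable M"
  using indep by (auto simp: indep_vars_def)

lemma walk_measurable [measurable]: "walk \<xi> n \<in> borel_measurable M"
  unfolding walk_def by measurable

lemma walk_0 [simp]: "walk \<xi> 0 \<omega> = 0"
  by (simp add: walk_def)

lemma walk_Suc: "walk \<xi> (Suc n) \<omega> = walk \<xi> n \<omega> + \<xi> (Suc n) \<omega>"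
  by (simp add: walk_def)

lemma sets_law [measurable_cong, simp]: "sets \<mu> = sets borel"
  using law[of 0] by auto

lemma prob_space_law: "prob_space \<mu>"
  using law[of 0] by (metis prob_space_distr increment_measurable)

definition stays :: "real set \<Rightarrow> nat \<Rightarrow> 'a set" where
  "stays I n = {\<omega> \<in> space M. \<forall>i\<le>n. walk \<xi> i \<omega> \<in> I}"

lemma stays_measurable [measurable]:
  assumes [measurable]: "I \<in> sets borel"
  shows "stays I n \<in> sets M"
proof -
  have [measurable]: "Measurable.pred M (\<lambda>\<omega>. walk \<xi> i \<omega> \<in> I)" for i
    by (rule pred_sets2[OF assms walk_measurable])
  show ?thesis unfolding stays_def by measurable
qed

lemma stays_Suc: "stays I (Suc n) = stays I n \<inter> {\<omega> \<in> space M. walk \<xi> (Suc n) \<omega> \<in> I}"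
  by (auto simp: stays_def le_Suc_eq)

lemma stays_0: "0 \<in> I \<Longrightarrow> stays I 0 = space M"
  by (auto simp: stays_def)

text \<open>
  The one-step Markov property. The event \<open>stays I n\<close> and the position at time \<open>n\<close> depend on
  \<open>\<xi> 1, \<dots>, \<xi> n\<close> only, so the next increment may be integrated out.
\<close>

lemma nn_integral_step:
  assumes f [measurable]: "f \<in> borel_measurable borel" and I [measurable]: "I \<in> sets borel"
  shows "(\<integral>\<^sup>+\<omega>. f (walk \<xi> (Suc n) \<omega>) * indicator (stays I n) \<omega> \<partial>M) =
         (\<integral>\<^sup>+\<omega>. (\<integral>\<^sup>+t. f (walk \<xi> n \<omega> + t) \<partial>\<mu>) * indicator (stays I n) \<omega> \<partial>M)"
proof -
  let ?P1 = "PiM {1..n} (\<lambda>_. borel :: real measure)" and ?P2 = "PiM {Suc n} (\<lambda>_. borel :: real measure)"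
  let ?X1 = "\<lambda>\<omega>. restrict (\<lambda>i. \<xi> i \<omega>) {1..n}" and ?X2 = "\<lambda>\<omega>. restrict (\<lambda>i. \<xi> i \<omega>) {Suc n}"
  let ?s = "\<lambda>v::nat \<Rightarrow> real. \<Sum>i=1..n. v i"
  let ?h = "\<lambda>(v, w). f (?s v + w (Suc n)) * (if \<forall>i\<le>n. (\<Sum>j=1..i. v j) \<in> I then 1 else 0) :: ennreal"
  have h [measurable]: "?h \<in> borel_measurable (?P1 \<Otimes>\<^sub>M ?P2)"
  proof -
    have s [measurable]: "(\<lambda>v. \<Sum>j=1..i. v j) \<in> borel_measurable ?P1" if "i \<le> n" for i
      using that by (intro borel_measurable_sum measurable_component_singleton) auto
    then have "Measurable.pred ?P1 (\<lambda>v. \<forall>i\<in>{..n}. (\<Sum>j=1..i. v j) \<in> I)"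
      by (intro pred_intros_finite) (auto intro!: pred_sets2[OF I])
    then have [measurable]: "Measurable.pred ?P1 (\<lambda>v. \<forall>i\<le>n. (\<Sum>j=1..i. v j) \<in> I)"
      by (simp add: Ball_def)
    have [measurable]: "(\<lambda>v. v (Suc n)) \<in> borel_measurable ?P2"
      by (rule measurable_component_singleton) simp
    have [measurable]: "?s \<in> borel_measurable ?P1" by (rule s) simp
    show ?thesis by measurable
  qed
  have iv: "indep_var ?P1 ?X1 ?P2 ?X2"
    by (rule indep_var_restrict[OF indep]) auto
  have X [measurable]: "?X1 \<in> measurable M ?P1" "?X2 \<in> measurable M ?P2"
    using iv by (auto dest: indep_var_rv1 indep_var_rv2)
  have joint: "distr M (?P1 \<Otimes>\<^sub>M ?P2) (\<lambda>\<omega>. (?X1 \<omega>, ?X2 \<omega>)) = distr M ?P1 ?X1 \<Otimes>\<^sub>M distr M ?P2 ?X2"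
    using iv unfolding indep_var_distribution_eq by simp
  interpret D2: prob_space "distr M ?P2 ?X2" by (rule prob_space_distr) measurable
  have h': "?h \<in> borel_measurable (distr M ?P1 ?X1 \<Otimes>\<^sub>M distr M ?P2 ?X2)"
    using h by (simp add: measurable_cong_sets[OF sets_pair_measure_cong[OF sets_distr sets_distr] refl])
  have "(\<integral>\<^sup>+\<omega>. f (walk \<xi> (Suc n) \<omega>) * indicator (stays I n) \<omega> \<partial>M) =
        (\<integral>\<^sup>+\<omega>. ?h (?X1 \<omega>, ?X2 \<omega>) \<partial>M)"
    by (intro nn_integral_cong) (simp add: walk_Suc stays_def indicator_def walk_def)
  also have "\<dots> = (\<integral>\<^sup>+p. ?h p \<partial>distr M (?P1 \<Otimes>\<^sub>M ?P2) (\<lambda>\<omega>. (?X1 \<omega>, ?X2 \<omega>)))"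
    by (rule nn_integral_distr[symmetric]) measurable
  also have "\<dots> = (\<integral>\<^sup>+v. (\<integral>\<^sup>+w. ?h (v, w) \<partial>distr M ?P2 ?X2) \<partial>distr M ?P1 ?X1)"
    unfolding joint by (rule D2.nn_integral_fst[symmetric, OF h'])
  also have "\<dots> = (\<integral>\<^sup>+v. (\<integral>\<^sup>+\<omega>'. ?h (v, ?X2 \<omega>') \<partial>M) \<partial>distr M ?P1 ?X1)"
    by (intro nn_integral_cong nn_integral_distr X measurable_Pair2[OF h]) simp
  also have "\<dots> = (\<integral>\<^sup>+\<omega>. (\<integral>\<^sup>+\<omega>'. ?h (?X1 \<omega>, ?X2 \<omega>') \<partial>M) \<partial>M)"
    by (rule nn_integral_distr[OF X(1)]) measurable
  also have "\<dots> = (\<integral>\<^sup>+\<omega>. (\<integral>\<^sup>+t. f (walk \<xi> n \<omega> + t) \<partial>\<mu>) * indicator (stays I n) \<omega> \<partial>M)"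
  proof (rule nn_integral_cong)
    fix \<omega> assume \<omega>: "\<omega> \<in> space M"
    have "(\<integral>\<^sup>+t. f (walk \<xi> n \<omega> + t) \<partial>\<mu>) = (\<integral>\<^sup>+\<omega>'. f (walk \<xi> n \<omega> + \<xi> (Suc n) \<omega>') \<partial>M)"
      unfolding law[of "Suc n", symmetric] by (rule nn_integral_distr) measurable
    then show "(\<integral>\<^sup>+\<omega>'. ?h (?X1 \<omega>, ?X2 \<omega>') \<partial>M) =
        (\<integral>\<^sup>+t. f (walk \<xi> n \<omega> + t) \<partial>\<mu>) * indicator (stays I n) \<omega>"
      using \<omega> by (simp add: stays_def walk_def)
  qed
  finally show ?thesis .
qed

definition occupation :: "real set \<Rightarrow> (real \<Rightarrow> ennreal) \<Rightarrow> ennreal" where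
  "occupation I f = (\<Sum>n. \<integral>\<^sup>+\<omega>. f (walk \<xi> n \<omega>) * indicator (stays I n) \<omega> \<partial>M)"

text \<open>
  If \<open>W + c\<close> dominates \<open>f\<close> plus the mean of \<open>W\<close> after one step of the walk killed outside \<open>I\<close>, then
  summing over time telescopes the values of \<open>W\<close>. The term \<open>c\<close> allows an error that is again an
  occupation sum.
\<close>

lemma occupation_le:
  assumes meas [measurable]: "W \<in> borel_measurable borel" "f \<in> borel_measurable borel"
      "c \<in> borel_measurable borel" "I \<in> sets borel"
    and "0 \<in> I"
    and drift: "\<And>y. y \<in> I \<Longrightarrow> f y + (\<integral>\<^sup>+t. W (y + t) * indicator I (y + t) \<partial>\<mu>) \<le> W y + c y"
  shows "occupation I f \<le> W 0 + occupation I c"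
proof -
  interpret L: prob_space \<mu> by (rule prob_space_law)
  let ?E = "\<lambda>g n. \<integral>\<^sup>+\<omega>. g (walk \<xi> n \<omega>) * indicator (stays I n) \<omega> \<partial>M :: ennreal"
  have step: "?E f n + ?E W (Suc n) \<le> ?E W n + ?E c n" for n
  proof -
    have "?E W (Suc n) =
      (\<integral>\<^sup>+\<omega>. W (walk \<xi> (Suc n) \<omega>) * indicator I (walk \<xi> (Suc n) \<omega>) * indicator (stays I n) \<omega> \<partial>M)"
      by (intro nn_integral_cong) (auto simp: stays_Suc indicator_def)
    also have "\<dots> = (\<integral>\<^sup>+\<omega>. (\<integral>\<^sup>+t. W (walk \<xi> n \<omega> + t) * indicator I (walk \<xi> n \<omega> + t) \<partial>\<mu>) *
                        indicator (stays I n) \<omega> \<partial>M)"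
      by (rule nn_integral_step) measurable
    finally have "?E f n + ?E W (Suc n) = (\<integral>\<^sup>+\<omega>. (f (walk \<xi> n \<omega>) +
         (\<integral>\<^sup>+t. W (walk \<xi> n \<omega> + t) * indicator I (walk \<xi> n \<omega> + t) \<partial>\<mu>)) *
         indicator (stays I n) \<omega> \<partial>M)"
      by (simp add: nn_integral_add[symmetric] distrib_right)
    also have "\<dots> \<le> (\<integral>\<^sup>+\<omega>. (W (walk \<xi> n \<omega>) + c (walk \<xi> n \<omega>)) * indicator (stays I n) \<omega> \<partial>M)"
    proof (intro nn_integral_mono)
      fix \<omega>
      show "(f (walk \<xi> n \<omega>) +
          (\<integral>\<^sup>+t. W (walk \<xi> n \<omega> + t) * indicator I (walk \<xi> n \<omega> + t) \<partial>\<mu>)) * indicator (stays I n) \<omega>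
        \<le> (W (walk \<xi> n \<omega>) + c (walk \<xi> n \<omega>)) * indicator (stays I n) \<omega>"
        using drift[of "walk \<xi> n \<omega>"] by (cases "\<omega> \<in> stays I n") (simp_all add: stays_def)
    qed
    also have "\<dots> = ?E W n + ?E c n"
      by (simp add: nn_integral_add[symmetric] distrib_right)
    finally show ?thesis .
  qed
  have *: "(\<Sum>n<N. ?E f n) + ?E W N \<le> W 0 + (\<Sum>n<N. ?E c n)" for N
  proof (induction N)
    case 0
    show ?case using \<open>0 \<in> I\<close> by (simp add: stays_0 emeasure_space_1)
  next
    case (Suc N)
    have "(\<Sum>n<Suc N. ?E f n) + ?E W (Suc N) = (\<Sum>n<N. ?E f n) + (?E f N + ?E W (Suc N))"
      by (simp add: add.assoc)
    also have "\<dots> \<le> (\<Sum>n<N. ?E f n) + (?E W N + ?E c N)"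
      by (intro add_left_mono step)
    also have "\<dots> = ((\<Sum>n<N. ?E f n) + ?E W N) + ?E c N"
      by (simp add: add.assoc)
    also have "\<dots> \<le> (W 0 + (\<Sum>n<N. ?E c n)) + ?E c N"
      by (intro add_right_mono Suc.IH)
    finally show ?case by (simp add: add.assoc)
  qed
  have **: "(\<Sum>n<N. ?E c n) \<le> occupation I c" for N
    unfolding occupation_def by (rule sum_le_suminf) auto
  have "(\<Sum>n<N. ?E f n) \<le> W 0 + occupation I c" for N
  proof -
    have "(\<Sum>n<N. ?E f n) \<le> (\<Sum>n<N. ?E f n) + ?E W N" by simp
    also have "\<dots> \<le> W 0 + (\<Sum>n<N. ?E c n)" by (rule *)
    also have "\<dots> \<le> W 0 + occupation I c" by (intro add_left_mono **)
    finally show ?thesis .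
  qed
  note *** = this
  show ?thesis
    unfolding occupation_def[of I f] by (rule suminf_le_const[OF summableI ***])
qed

lemma less_tau_iff: "enat n < tau \<xi> \<omega> \<longleftrightarrow> (\<forall>i\<le>n. walk \<xi> i \<omega> \<ge> 0)"
proof -
  let ?N = "{n. n \<ge> 1 \<and> walk \<xi> n \<omega> < 0}"
  show ?thesis
  proof (cases "?N = {}")
    case True
    have "tau \<xi> \<omega> = \<infinity>" unfolding tau_def True by (simp add: Inf_enat_def)
    moreover have "walk \<xi> i \<omega> \<ge> 0" for i
    proof (cases i)
      case (Suc j)
      have "i \<notin> ?N" using True by blast
      then show ?thesis using Suc by auto
    qed simp
    ultimately show ?thesis by simp
  next
    case False
    then obtain j where j: "j \<in> ?N" by auto
    define k where "k = (LEAST k. k \<in> ?N)"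
    have k: "k \<in> ?N" "\<And>j. j \<in> ?N \<Longrightarrow> k \<le> j"
      unfolding k_def by (fact LeastI[of "\<lambda>k. k \<in> ?N", OF j], fact Least_le[of "\<lambda>k. k \<in> ?N"])
    have "tau \<xi> \<omega> = enat k"
      unfolding tau_def by (intro antisym Inf_lower Inf_greatest) (use k in auto)
    moreover have "n < k \<longleftrightarrow> (\<forall>i\<le>n. walk \<xi> i \<omega> \<ge> 0)"
    proof
      assume "n < k"
      show "\<forall>i\<le>n. walk \<xi> i \<omega> \<ge> 0"
      proof (intro allI impI)
        fix i assume "i \<le> n"
        show "walk \<xi> i \<omega> \<ge> 0"
        proof (cases "i = 0")
          case False
          then have "i \<notin> ?N" using k(2)[of i] \<open>i \<le> n\<close> \<open>n < k\<close> by linarith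
          then show ?thesis using False by auto
        qed simp
      qed
    next
      assume "\<forall>i\<le>n. walk \<xi> i \<omega> \<ge> 0"
      then show "n < k" using k(1) by (auto simp: not_less[symmetric])
    qed
    ultimately show ?thesis by simp
  qed
qed

text \<open>
  The first passage above \<open>x\<close> occurs at a step \<open>Suc n\<close> up to which the walk has stayed in \<open>[0,x]\<close>;
  the passage cannot happen at time \<open>\<tau>\<close> itself, where the walk is negative.
\<close>

lemma M_tau_greater_iff:
  assumes "x \<ge> 0"
  shows "M_tau \<xi> \<omega> > ereal x \<longleftrightarrow>
    (\<exists>n. (\<forall>i\<le>n. walk \<xi> i \<omega> \<in> {0..x}) \<and> walk \<xi> (Suc n) \<omega> > x)"
proof
  assume "M_tau \<xi> \<omega> > ereal x"
  then have ex: "\<exists>i. enat i \<le> tau \<xi> \<omega> \<and> walk \<xi> i \<omega> > x"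
    by (auto simp: M_tau_def less_SUP_iff)
  define k where "k = (LEAST i. enat i \<le> tau \<xi> \<omega> \<and> walk \<xi> i \<omega> > x)"
  have k: "enat k \<le> tau \<xi> \<omega>" "walk \<xi> k \<omega> > x"
    using LeastI_ex[OF ex] unfolding k_def by auto
  have below: "\<not> (enat i \<le> tau \<xi> \<omega> \<and> walk \<xi> i \<omega> > x)" if "i < k" for i
    using not_less_Least that unfolding k_def by blast
  obtain n where n: "k = Suc n"
    using k(2) \<open>x \<ge> 0\<close> by (cases k) auto
  have "enat n < tau \<xi> \<omega>" using k(1) n by (metis Suc_ile_eq)
  then have "walk \<xi> i \<omega> \<ge> 0" if "i \<le> n" for i using that less_tau_iff by blast
  moreover have "walk \<xi> i \<omega> \<le> x" if "i \<le> n" for i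
  proof -
    have "enat i \<le> enat n" using that by simp
    also have "\<dots> \<le> tau \<xi> \<omega>" using \<open>enat n < tau \<xi> \<omega>\<close> by (rule less_imp_le)
    finally show ?thesis using below[of i] that n by auto
  qed
  ultimately show "\<exists>n. (\<forall>i\<le>n. walk \<xi> i \<omega> \<in> {0..x}) \<and> walk \<xi> (Suc n) \<omega> > x"
    using k(2) n by auto
next
  assume "\<exists>n. (\<forall>i\<le>n. walk \<xi> i \<omega> \<in> {0..x}) \<and> walk \<xi> (Suc n) \<omega> > x"
  then obtain n where n: "\<forall>i\<le>n. walk \<xi> i \<omega> \<in> {0..x}" "walk \<xi> (Suc n) \<omega> > x" by blast
  then have "enat n < tau \<xi> \<omega>" by (simp add: less_tau_iff)
  then have "enat (Suc n) \<le> tau \<xi> \<omega>" by (simp add: Suc_ile_eq)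
  then show "M_tau \<xi> \<omega> > ereal x"
    using n(2) by (auto simp: M_tau_def less_SUP_iff)
qed

lemma emeasure_M_tau_greater:
  assumes "x \<ge> 0"
  shows "emeasure M {\<omega> \<in> space M. M_tau \<xi> \<omega> > ereal x} =
    occupation {0..x} (\<lambda>y. emeasure \<mu> {x - y<..})"
proof -
  interpret L: prob_space \<mu> by (rule prob_space_law)
  define D where "D n = {\<omega> \<in> space M. (\<forall>i\<le>n. walk \<xi> i \<omega> \<in> {0..x}) \<and> walk \<xi> (Suc n) \<omega> > x}" for n
  have [measurable]: "D n \<in> sets M" for n unfolding D_def by measurable
  have "disjoint_family D"
  proof -
    have "D m \<inter> D n = {}" if "m < n" for m n :: nat
    proof -
      have "Suc m \<le> n" using that by simp
      then show ?thesis unfolding D_def by (fastforce simp: not_le[symmetric])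
    qed
    then show ?thesis
      unfolding disjoint_family_on_def by (metis Int_commute linorder_neqE_nat)
  qed
  have "{\<omega> \<in> space M. M_tau \<xi> \<omega> > ereal x} = (\<Union>n. D n)"
    using M_tau_greater_iff[OF assms] by (auto simp: D_def)
  then have total: "emeasure M {\<omega> \<in> space M. M_tau \<xi> \<omega> > ereal x} = (\<Sum>n. emeasure M (D n))"
    using \<open>disjoint_family D\<close> by (simp add: suminf_emeasure image_subset_iff)
  have each: "emeasure M (D n) =
      (\<integral>\<^sup>+\<omega>. emeasure \<mu> {x - walk \<xi> n \<omega><..} * indicator (stays {0..x} n) \<omega> \<partial>M)" for n
  proof -
    have shift: "(\<integral>\<^sup>+t. indicator {x<..} (y + t) \<partial>\<mu>) = emeasure \<mu> {x - y<..}" for y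
      by (subst nn_integral_indicator[symmetric], simp)
         (intro nn_integral_cong, auto simp: indicator_def)
    have "emeasure M (D n) =
      (\<integral>\<^sup>+\<omega>. indicator {x<..} (walk \<xi> (Suc n) \<omega>) * indicator (stays {0..x} n) \<omega> \<partial>M)"
      by (subst nn_integral_indicator[symmetric], simp)
         (intro nn_integral_cong, auto simp: D_def stays_def indicator_def)
    also have "\<dots> = (\<integral>\<^sup>+\<omega>. (\<integral>\<^sup>+t. indicator {x<..} (walk \<xi> n \<omega> + t) \<partial>\<mu>) *
                         indicator (stays {0..x} n) \<omega> \<partial>M)"
      by (rule nn_integral_step) auto
    also have "\<dots> = (\<integral>\<^sup>+\<omega>. emeasure \<mu> {x - walk \<xi> n \<omega><..} * indicator (stays {0..x} n) \<omega> \<partial>M)"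
      by (simp only: shift)
    finally show ?thesis .
  qed
  show ?thesis unfolding occupation_def total each ..
qed

lemma mean_tau_eq: "mean_tau M \<xi> = (\<Sum>n. emeasure M (stays {0..} n))"
proof -
  have m: "tau \<xi> \<in> measurable M (count_space UNIV)"
  proof (rule measurable_count_space_eq_countable[THEN iffD2, of UNIV])
    show "countable (UNIV :: enat set)" by simp
    have "tau \<xi> -` {e} \<inter> space M \<in> sets M" for e
    proof -
      have *: "{\<omega> \<in> space M. enat n < tau \<xi> \<omega>} \<in> sets M" for n
        unfolding less_tau_iff by measurable
      show ?thesis
      proof (cases e)
        case (enat k)
        have "t = enat k \<longleftrightarrow> (k = 0 \<or> enat (k - 1) < t) \<and> \<not> enat k < t" for t
          by (cases t; cases k) auto
        then have "tau \<xi> -` {e} \<inter> space M =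
          (if k = 0 then space M else {\<omega> \<in> space M. enat (k - 1) < tau \<xi> \<omega>}) -
          {\<omega> \<in> space M. enat k < tau \<xi> \<omega>}"
          unfolding enat by (auto simp del: not_less split: if_splits)
        then show ?thesis using * by auto
      next
        case infinity
        have "tau \<xi> -` {e} \<inter> space M = (\<Inter>n. {\<omega> \<in> space M. enat n < tau \<xi> \<omega>})"
        proof -
          have "t = \<infinity> \<longleftrightarrow> (\<forall>n. enat n < t)" for t
            by (cases t) auto
          then show ?thesis unfolding infinity by auto
        qed
        then show ?thesis using * by auto
      qed
    qed
    then show "tau \<xi> \<in> space M \<rightarrow> UNIV \<and> (\<forall>a\<in>UNIV. tau \<xi> -` {a} \<inter> space M \<in> sets M)" by simp
  qed
  have "mean_tau M \<xi> = (\<Sum>n. emeasure M {\<omega> \<in> space M. enat n < tau \<xi> \<omega>})"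
    unfolding mean_tau_def by (rule nn_integral_enat_function[OF m])
  then show ?thesis by (simp add: less_tau_iff stays_def)
qed

lemma eventually_above_walk: "\<forall>\<^sub>F x in at_top. \<forall>i\<le>n. walk \<xi> i \<omega> \<le> x"
proof -
  have "\<forall>\<^sub>F x in at_top. \<forall>i\<in>{..n}. walk \<xi> i \<omega> \<le> x"
    by (intro eventually_ball_finite) (auto intro: eventually_ge_at_top)
  then show ?thesis by (simp add: Ball_def)
qed

lemma prob_stays_Icc_tendsto: "((\<lambda>x. prob (stays {0..x} n)) \<longlongrightarrow> prob (stays {0..} n)) at_top"
proof -
  have "((\<lambda>x. \<integral>\<omega>. indicator (stays {0..x} n) \<omega> \<partial>M) \<longlongrightarrow> (\<integral>\<omega>. indicator (stays {0..} n) \<omega> \<partial>M :: real)) at_top"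
  proof (rule integral_dominated_convergence_at_top[where w="\<lambda>_. 1"])
    show "AE \<omega> in M. ((\<lambda>x. indicator (stays {0..x} n) \<omega> :: real) \<longlongrightarrow> indicator (stays {0..} n) \<omega>) at_top"
    proof (rule AE_I2, rule tendsto_eventually)
      fix \<omega>
      show "\<forall>\<^sub>F x in at_top. indicator (stays {0..x} n) \<omega> = (indicator (stays {0..} n) \<omega> :: real)"
        using eventually_above_walk by eventually_elim (auto simp: stays_def indicator_def)
    qed
  qed (auto simp: indicator_def)
  then show ?thesis by simp
qed

text \<open>
  The event that \<open>\<tau> > n\<close> and that the walk is far up at time \<open>n\<close>. Crossings of \<open>x\<close> that start from
  such positions have to be shown to be rare.
\<close>

definition stays_above :: "real \<Rightarrow> nat \<Rightarrow> 'a set" where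
  "stays_above A n = {\<omega> \<in> stays {0..} n. walk \<xi> n \<omega> > A}"

lemma stays_above_measurable [measurable]: "stays_above A n \<in> sets M"
proof -
  have "stays_above A n = stays {0..} n \<inter> {\<omega> \<in> space M. walk \<xi> n \<omega> > A}"
    by (auto simp: stays_above_def stays_def)
  then show ?thesis by simp
qed

lemma prob_stays_above_tendsto: "((\<lambda>A. prob (stays_above A n)) \<longlongrightarrow> 0) at_top"
proof -
  have "((\<lambda>A. \<integral>\<omega>. indicator (stays_above A n) \<omega> \<partial>M) \<longlongrightarrow> (\<integral>\<omega>. 0 \<partial>M :: real)) at_top"
  proof (rule integral_dominated_convergence_at_top[where w="\<lambda>_. 1"])
    show "AE \<omega> in M. ((\<lambda>A. indicator (stays_above A n) \<omega> :: real) \<longlongrightarrow> 0) at_top"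
    proof (rule AE_I2, rule tendsto_eventually)
      fix \<omega>
      show "\<forall>\<^sub>F A in at_top. indicator (stays_above A n) \<omega> = (0 :: real)"
        using eventually_ge_at_top[of "walk \<xi> n \<omega>"]
        by eventually_elim (auto simp: stays_above_def indicator_def)
    qed
  qed (auto simp: indicator_def)
  then show ?thesis by simp
qed

end

section \<open>The maximum before the first descent below zero\<close>

text \<open>
  Dominated convergence for series with a real parameter, an instance of Tannery's theorem.
\<close>

lemma suminf_dominated_tendsto:
  fixes a :: "nat \<Rightarrow> real \<Rightarrow> real"
  assumes "\<And>n. ((\<lambda>x. a n x) \<longlongrightarrow> b n) at_top" "\<And>n x. \<bar>a n x\<bar> \<le> p n" "summable p"
  shows "((\<lambda>x. \<Sum>n. a n x) \<longlongrightarrow> (\<Sum>n. b n)) at_top"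
  using tannerys_theorem[of a b at_top p] assms by (auto intro: always_eventually)

locale subexponential_walk =
  iid_walk M \<xi> \<mu> + L: subexponential_law \<mu> for M :: "'a measure" and \<xi> and \<mu>
begin

definition E\<tau> :: real where
  "E\<tau> = (\<Sum>n. prob (stays {0..} n))"

lemma occupation_finite: "(\<Sum>n. emeasure M (stays {0..} n)) < \<infinity>"
proof -
  obtain Y where Y: "Y \<in> borel_measurable borel" "\<And>y. Y y \<ge> 0"
    "\<And>y. y \<ge> 0 \<Longrightarrow>
      1 + (\<integral>\<^sup>+t. ennreal (Y (y + t)) * indicator {0..} (y + t) \<partial>\<mu>) \<le> ennreal (Y y)"
    by (rule L.supersolution_half_line) (rule that)
  have "(\<Sum>n. emeasure M (stays {0..} n)) = occupation {0..} (\<lambda>_. 1)"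
    unfolding occupation_def by simp
  also have "\<dots> \<le> ennreal (Y 0) + occupation {0..} (\<lambda>_. 0)"
    by (rule occupation_le) (use Y in auto)
  also have "occupation {0..} (\<lambda>_. 0) = 0" by (simp add: occupation_def)
  finally show ?thesis by (simp add: le_less_trans[of _ "ennreal (Y 0)"])
qed

lemma summable_stays: "summable (\<lambda>n. prob (stays {0..} n))"
proof (rule summable_suminf_not_top)
  show "(\<Sum>n. ennreal (prob (stays {0..} n))) \<noteq> \<top>"
    using occupation_finite by (simp add: emeasure_eq_measure)
qed simp

lemma mean_tau_eq_E\<tau>: "enn2real (mean_tau M \<xi>) = E\<tau>"
proof -
  have "mean_tau M \<xi> = ennreal E\<tau>"
    unfolding mean_tau_eq emeasure_eq_measure E\<tau>_def by (rule suminf_ennreal2[OF _ summable_stays]) simp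
  moreover have "E\<tau> \<ge> 0" unfolding E\<tau>_def by (rule suminf_nonneg[OF summable_stays]) simp
  ultimately show ?thesis by simp
qed

lemma E\<tau>_pos: "E\<tau> > 0"
proof -
  have "prob (stays {0..} 0) = 1" by (simp add: stays_0 prob_space)
  then show ?thesis
    unfolding E\<tau>_def by (intro suminf_pos2[OF summable_stays, of 0]) auto
qed

abbreviation exceed :: "real \<Rightarrow> real" where
  "exceed x \<equiv> prob {\<omega> \<in> space M. M_tau \<xi> \<omega> > ereal x}"

lemma emeasure_exceed:
  "x \<ge> 0 \<Longrightarrow> ennreal (exceed x) = occupation {0..x} (\<lambda>y. ennreal (L.T (x - y)))"
  using emeasure_M_tau_greater[of x] by (simp add: emeasure_eq_measure L.emeasure_eq_measure L.T_def)

text \<open>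
  From any position in \<open>[0,x]\<close> a single step larger than \<open>x\<close> crosses the level.
\<close>

lemma exceed_lower:
  assumes "x \<ge> 0"
  shows "L.T x * (\<Sum>n. prob (stays {0..x} n)) \<le> exceed x"
proof -
  have sub: "prob (stays {0..x} n) \<le> prob (stays {0..} n)" for n
    by (intro finite_measure_mono) (auto simp: stays_def)
  have summ: "summable (\<lambda>n. prob (stays {0..x} n))"
    by (rule summable_comparison_test'[OF summable_stays]) (use sub in auto)
  have "ennreal (L.T x * (\<Sum>n. prob (stays {0..x} n))) = (\<Sum>n. ennreal (L.T x * prob (stays {0..x} n)))"
    using summ by (simp add: suminf_mult[symmetric] suminf_ennreal2 less_imp_le)
  also have "\<dots> \<le> occupation {0..x} (\<lambda>y. ennreal (L.T (x - y)))"
    unfolding occupation_def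
  proof (intro suminf_le allI)
    fix n
    have "ennreal (L.T x * prob (stays {0..x} n)) = (\<integral>\<^sup>+\<omega>. ennreal (L.T x) * indicator (stays {0..x} n) \<omega> \<partial>M)"
      by (simp add: nn_integral_cmult_indicator emeasure_eq_measure ennreal_mult less_imp_le)
    also have "\<dots> \<le> (\<integral>\<^sup>+\<omega>. ennreal (L.T (x - walk \<xi> n \<omega>)) * indicator (stays {0..x} n) \<omega> \<partial>M)"
      by (intro nn_integral_mono) (auto simp: stays_def indicator_def intro!: ennreal_leI L.T_antimono)
    finally show "ennreal (L.T x * prob (stays {0..x} n)) \<le>
      (\<integral>\<^sup>+\<omega>. ennreal (L.T (x - walk \<xi> n \<omega>)) * indicator (stays {0..x} n) \<omega> \<partial>M)" .
  qed auto
  also have "\<dots> = ennreal (exceed x)" by (rule emeasure_exceed[OF assms, symmetric])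
  finally show ?thesis by (subst (asm) ennreal_le_iff) auto
qed

text \<open>
  With \<open>b = 1 + \<epsilon>\<close>, this turns the supersolution on \<open>[0,x]\<close> into the bound of the crossing
  probability; enlarging \<open>[0,x]\<close> to \<open>[0,\<infinity>)\<close> on the right-hand side removes the dependence on \<open>x\<close>
  from the occupation sums.
\<close>

lemma exceed_upper:
  assumes x: "x \<ge> 0" and c: "\<kappa> \<ge> 0" "b \<ge> 0"
    and W: "W \<in> borel_measurable borel" "W 0 = 0"
      "\<And>y. y \<in> {0..x} \<Longrightarrow>
        ennreal (L.T (x - y)) + (\<integral>\<^sup>+t. W (y + t) * indicator {0..x} (y + t) \<partial>\<mu>) \<le>
        W y + ennreal (L.T x * (b + \<kappa> * indicator {A<..} y))"
  shows "exceed x \<le> L.T x * (b * E\<tau> + \<kappa> * (\<Sum>n. prob (stays_above A n)))"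
proof -
  have sub: "prob (stays_above A n) \<le> prob (stays {0..} n)" for n
    by (intro finite_measure_mono) (auto simp: stays_above_def)
  have summ: "summable (\<lambda>n. prob (stays_above A n))"
    by (rule summable_comparison_test'[OF summable_stays]) (use sub in auto)
  let ?c = "\<lambda>y. ennreal (L.T x * (b + \<kappa> * indicator {A<..} y))"
  have "ennreal (exceed x) = occupation {0..x} (\<lambda>y. ennreal (L.T (x - y)))"
    by (rule emeasure_exceed[OF x])
  also have "\<dots> \<le> W 0 + occupation {0..x} ?c"
    by (rule occupation_le) (use W x in auto)
  also have "\<dots> = occupation {0..x} ?c" using W by simp
  also have "\<dots> \<le> (\<Sum>n. ennreal (L.T x * (b * prob (stays {0..} n) + \<kappa> * prob (stays_above A n))))"
    unfolding occupation_def
  proof (intro suminf_le allI)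
    fix n
    have "(\<integral>\<^sup>+\<omega>. ?c (walk \<xi> n \<omega>) * indicator (stays {0..x} n) \<omega> \<partial>M) \<le>
      (\<integral>\<^sup>+\<omega>. ennreal (L.T x * b) * indicator (stays {0..} n) \<omega> +
          ennreal (L.T x * \<kappa>) * indicator (stays_above A n) \<omega> \<partial>M)"
      using c by (intro nn_integral_mono)
        (auto simp: stays_def stays_above_def indicator_def ennreal_plus[symmetric] algebra_simps less_imp_le
          simp del: ennreal_plus)
    also have "\<dots> = ennreal (L.T x * (b * prob (stays {0..} n) + \<kappa> * prob (stays_above A n)))"
      using c by (simp add: nn_integral_add nn_integral_cmult_indicator emeasure_eq_measure
          ennreal_mult[symmetric] ennreal_plus[symmetric] less_imp_le algebra_simps del: ennreal_plus)
    finally show "(\<integral>\<^sup>+\<omega>. ?c (walk \<xi> n \<omega>) * indicator (stays {0..x} n) \<omega> \<partial>M) \<le>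
        ennreal (L.T x * (b * prob (stays {0..} n) + \<kappa> * prob (stays_above A n)))" .
  qed auto
  also have "\<dots> = ennreal (\<Sum>n. L.T x * (b * prob (stays {0..} n) + \<kappa> * prob (stays_above A n)))"
    using c by (intro suminf_ennreal2 summable_mult summable_add summable_stays summ)
      (auto intro!: mult_nonneg_nonneg add_nonneg_nonneg simp: less_imp_le)
  also have "(\<Sum>n. L.T x * (b * prob (stays {0..} n) + \<kappa> * prob (stays_above A n))) =
      L.T x * (b * E\<tau> + \<kappa> * (\<Sum>n. prob (stays_above A n)))"
    unfolding E\<tau>_def
    by (simp add: suminf_mult suminf_add[symmetric] summable_mult summable_add summable_stays summ)
  finally show ?thesis
  proof (subst (asm) ennreal_le_iff)
    have "E\<tau> \<ge> 0" "(\<Sum>n. prob (stays_above A n)) \<ge> 0"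
      using E\<tau>_pos suminf_nonneg[OF summ] by auto
    then show "0 \<le> L.T x * (b * E\<tau> + \<kappa> * (\<Sum>n. prob (stays_above A n)))"
      using c by (intro mult_nonneg_nonneg add_nonneg_nonneg) (auto simp: less_imp_le)
  qed
qed

lemma exceed_ratio_tendsto: "((\<lambda>x. exceed x / L.T x) \<longlongrightarrow> E\<tau>) at_top"
proof (rule order_tendstoI)
  fix a assume "a < E\<tau>"
  have "((\<lambda>x. \<Sum>n. prob (stays {0..x} n)) \<longlongrightarrow> (\<Sum>n. prob (stays {0..} n))) at_top"
  proof (rule suminf_dominated_tendsto[OF prob_stays_Icc_tendsto _ summable_stays])
    show "\<bar>prob (stays {0..x} n)\<bar> \<le> prob (stays {0..} n)" for n x
      by simp (intro finite_measure_mono, auto simp: stays_def)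
  qed
  then have "\<forall>\<^sub>F x in at_top. a < (\<Sum>n. prob (stays {0..x} n))"
    by (rule order_tendstoD(1)) (use \<open>a < E\<tau>\<close> in \<open>simp add: E\<tau>_def\<close>)
  with eventually_ge_at_top[of 0] show "\<forall>\<^sub>F x in at_top. a < exceed x / L.T x"
  proof eventually_elim
    case (elim x)
    have "(\<Sum>n. prob (stays {0..x} n)) \<le> exceed x / L.T x"
      using exceed_lower[OF elim(1)] by (simp add: pos_le_divide_eq mult.commute)
    then show ?case using elim(2) by simp
  qed
next
  fix a assume a: "E\<tau> < a"
  \<comment> \<open>small enough for \<open>(1 + \<epsilon>) E\<tau> + \<epsilon> < a\<close>; the last \<open>\<epsilon>\<close> is reserved for positions above \<open>A\<close>\<close>
  define \<epsilon> where "\<epsilon> = min 1 ((a - E\<tau>) / (2 * (E\<tau> + 1)))"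
  have \<epsilon>: "0 < \<epsilon>" "\<epsilon> \<le> 1" using a E\<tau>_pos by (auto simp: \<epsilon>_def)
  have "\<epsilon> \<le> (a - E\<tau>) / (2 * (E\<tau> + 1))" by (simp add: \<epsilon>_def)
  then have "\<epsilon> * (2 * (E\<tau> + 1)) \<le> a - E\<tau>"
    using E\<tau>_pos by (simp add: pos_le_divide_eq)
  moreover have "0 < \<epsilon> * (E\<tau> + 1)" using \<epsilon> E\<tau>_pos by simp
  ultimately have budget: "(1 + \<epsilon>) * E\<tau> + \<epsilon> < a" by (simp add: algebra_simps)
  obtain \<kappa> where \<kappa>: "\<kappa> \<ge> 0"
    "\<And>A. A > 0 \<Longrightarrow> \<forall>\<^sub>F x in at_top. \<exists>W. W \<in> borel_measurable borel \<and> W 0 = 0 \<and>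
       (\<forall>y\<in>{0..x}. ennreal (L.T (x - y)) + (\<integral>\<^sup>+t. W (y + t) * indicator {0..x} (y + t) \<partial>\<mu>) \<le>
          W y + ennreal (L.T x * (1 + \<epsilon> + \<kappa> * indicator {A<..} y)))"
    by (rule L.supersolution_interval[OF \<epsilon>]) (rule that)
  have "((\<lambda>A. \<Sum>n. prob (stays_above A n)) \<longlongrightarrow> (\<Sum>n. 0)) at_top"
  proof (rule suminf_dominated_tendsto[OF prob_stays_above_tendsto _ summable_stays])
    show "\<bar>prob (stays_above A n)\<bar> \<le> prob (stays {0..} n)" for n A
      by simp (intro finite_measure_mono, auto simp: stays_above_def)
  qed
  then have "((\<lambda>A. \<kappa> * (\<Sum>n. prob (stays_above A n))) \<longlongrightarrow> \<kappa> * 0) at_top"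
    by (intro tendsto_mult tendsto_const) simp
  then have "\<forall>\<^sub>F A in at_top. \<kappa> * (\<Sum>n. prob (stays_above A n)) < \<epsilon> \<and> A > 0"
    by (intro eventually_conj order_tendstoD(2) eventually_gt_at_top) (use \<epsilon> in auto)
  then obtain A where A: "\<kappa> * (\<Sum>n. prob (stays_above A n)) < \<epsilon>" "A > 0"
    by (auto simp: eventually_at_top_linorder)
  from \<kappa>(2)[OF A(2)] eventually_ge_at_top[of 0]
  show "\<forall>\<^sub>F x in at_top. exceed x / L.T x < a"
  proof eventually_elim
    case (elim x)
    then obtain W where "W \<in> borel_measurable borel" "W 0 = 0"
      "\<And>y. y \<in> {0..x} \<Longrightarrow>
        ennreal (L.T (x - y)) + (\<integral>\<^sup>+t. W (y + t) * indicator {0..x} (y + t) \<partial>\<mu>) \<le>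
        W y + ennreal (L.T x * (1 + \<epsilon> + \<kappa> * indicator {A<..} y))"
      by blast
    from exceed_upper[OF elim(2) \<kappa>(1) _ this]
    have "exceed x / L.T x \<le> (1 + \<epsilon>) * E\<tau> + \<kappa> * (\<Sum>n. prob (stays_above A n))"
      using \<epsilon> by (simp add: pos_divide_le_eq mult.commute)
    then show ?case using A(1) budget by linarith
  qed
qed

end

theorem theorem7:
  fixes M :: "'a measure" and \<xi> :: "nat \<Rightarrow> 'a \<Rightarrow> real" and F :: "real \<Rightarrow> real"
  assumes "prob_space M"
    and "prob_space.indep_vars M (\<lambda>_. borel) \<xi> UNIV"
    and "\<And>n. cdf (distr M borel (\<xi> n)) = F"
    and "(\<integral>\<^sup>+\<omega>. ennreal (neg_part (\<xi> 0 \<omega>)) \<partial>M) = \<infinity>"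
    and "K_const F (trunc_mean M (\<xi> 0)) < \<infinity>"
    and "G1 F (trunc_mean M (\<xi> 0)) \<in> class_S F"
  shows "(\<lambda>x. measure M {\<omega> \<in> space M. M_tau \<xi> \<omega> > ereal x})
           \<sim>[at_top] (\<lambda>x. enn2real (mean_tau M \<xi>) * tail F x)"
proof -
  interpret prob_space M by fact
  have \<xi> [measurable]: "\<xi> n \<in> borel_measurable M" for n
    using assms(2) by (auto simp: indep_vars_def)
  define \<mu> where "\<mu> = distr M borel (\<xi> 0)"
  have rd: "real_distribution (distr M borel (\<xi> n))" for n
    by (rule real_distribution_distr) simp
  interpret \<mu>: real_distribution \<mu> unfolding \<mu>_def by (rule rd)
  have F: "F = cdf \<mu>" using assms(3) by (simp add: \<mu>_def)
  have law: "distr M borel (\<xi> n) = \<mu>" for n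
    unfolding \<mu>_def by (rule cdf_unique) (use rd assms(3) in auto)
  have np [measurable]: "neg_part \<in> borel_measurable borel"
    unfolding neg_part_def[abs_def] by measurable
  have m: "trunc_mean M (\<xi> 0) = trunc_mean \<mu> (\<lambda>t. t)"
    unfolding trunc_mean_def \<mu>_def by (subst integral_distr) auto
  have "(\<integral>\<^sup>+t. ennreal (neg_part t) \<partial>\<mu>) = \<infinity>"
    unfolding \<mu>_def using assms(4) by (subst nn_integral_distr) auto
  moreover have "(\<integral>\<^sup>+t\<in>{0<..}. ennreal (t / trunc_mean \<mu> (\<lambda>t. t) t) \<partial>\<mu>) < \<infinity>"
    using assms(5) unfolding K_const_def F \<mu>.interval_measure_cdf m .
  ultimately interpret W: subexponential_walk M \<xi> \<mu>
    using assms(2,6) law by unfold_locales (auto simp: F m)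
  have "((\<lambda>x. W.exceed x / tail F x) \<longlongrightarrow> W.E\<tau>) at_top"
    unfolding F W.L.tail_cdf by (rule W.exceed_ratio_tendsto)
  then show ?thesis
    unfolding W.mean_tau_eq_E\<tau> by (rule asymp_equivI'_const) (use W.E\<tau>_pos in simp)
qed

end
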